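(* Let $n\ge 2$ and $k\ge1$ be integers. There exists a Markovian avoidance coupling of $k$ walkers on $K_n^*$ whenever $k\le n/(8\log_2 n)$, and there exists a Markovian avoidance coupling of $k$ walkers on $K_n$ whenever $k\le n/(56\log_2 n)$.
   Context: $K_n$ is the loopless complete graph on $n$ vertices; a random walk on it moves at each step to a uniformly random vertex other than its current one. $K_n^*$ is the complete graph on $n$ vertices with a single self-loop at each vertex; a random walk on it moves at each step to a uniformly random vertex among all $n$ (so it stays in place with probability $1/n$). Walkers $1,\dots,k$ take turns to move in discrete time in the fixed cyclic order $X^{(1)}_0,\dots,X^{(k)}_0,X^{(1)}_1,\dots,X^{(k)}_1,\dots$. A coupling is a realization of all the walks on a common probability space such that each $(X^{(j)}_t)_{t\ge0}$, viewed separately, is a random walk on the graph (the initial states may be coupled in an arbitrary way). A collision occurs exactly if a walker moves to a vertex currently occupied by another; i.e. the collisions are the events $X^{(i)}_t=X^{(j)}_t$ for $i\ne j$ and $X^{(i)}_{t+1}=X^{(j)}_t$ for $i<j$ ($t\ge 0$). An avoidance coupling is a coupling in which (almost surely) no collision ever occurs. A coupling is Markovian if it is itself a time-homogeneous Markov chain: given the whole past, the conditional law of each move depends only on the current locations of all the walkers and on whose turn it is to move. *)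

theory Defs
  imports "HOL-Probability.Probability"
begin

text \<open>The vertices are \<open>{..<n}\<close> and a graph is given by its neighbourhood map; a self-loop at
  \<open>v\<close> makes \<open>v\<close> a neighbour of itself.\<close>

definition nbhd_K :: "nat \<Rightarrow> nat \<Rightarrow> nat set" where
  "nbhd_K n v = {..<n} - {v}"

definition nbhd_K_star :: "nat \<Rightarrow> nat \<Rightarrow> nat set" where
  "nbhd_K_star n v = {..<n}"

text \<open>The initial law is arbitrary. Only histories of positive probability are constrained,
  because \<^const>\<open>cond_prob\<close> is \<open>0\<close> when the conditioning event is null.\<close>

definition random_walk ::
    "'w measure \<Rightarrow> 'v set \<Rightarrow> ('v \<Rightarrow> 'v set) \<Rightarrow> (nat \<Rightarrow> 'w \<Rightarrow> 'v) \<Rightarrow> bool" where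
  "random_walk M V N Y \<longleftrightarrow>
     (\<forall>t. Y t \<in> measurable M (count_space V)) \<and>
     (\<forall>t h. \<P>(\<omega> in M. \<forall>s\<le>t. Y s \<omega> = h s) > 0 \<longrightarrow>
        (\<forall>y. \<P>(\<omega> in M. Y (Suc t) \<omega> = y \<bar> \<forall>s\<le>t. Y s \<omega> = h s) =
             pmf (pmf_of_set (N (h t))) y))"

text \<open>\<open>X j t\<close> is the position of walker \<open>j\<close> after \<open>t\<close> moves. The walkers are \<open>0, \<dots>, k - 1\<close>
  and take turns in increasing order.\<close>

definition coupling ::
    "'w measure \<Rightarrow> nat \<Rightarrow> 'v set \<Rightarrow> ('v \<Rightarrow> 'v set) \<Rightarrow> (nat \<Rightarrow> nat \<Rightarrow> 'w \<Rightarrow> 'v) \<Rightarrow> bool" where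
  "coupling M k V N X \<longleftrightarrow> prob_space M \<and> (\<forall>j<k. random_walk M V N (X j))"

definition avoiding :: "'w measure \<Rightarrow> nat \<Rightarrow> (nat \<Rightarrow> nat \<Rightarrow> 'w \<Rightarrow> 'v) \<Rightarrow> bool" where
  "avoiding M k X \<longleftrightarrow>
     (AE \<omega> in M. \<forall>t. \<forall>i<k. \<forall>j<k.
        (i \<noteq> j \<longrightarrow> X i t \<omega> \<noteq> X j t \<omega>) \<and>
        (i < j \<longrightarrow> X i (Suc t) \<omega> \<noteq> X j t \<omega>))"

text \<open>The indices \<open>(i, s)\<close> of the positions \<open>X i s\<close> already determined when walker \<open>j\<close> is about
  to move from \<open>X j t\<close> to \<open>X j (Suc t)\<close>, and the locations of all the walkers at that moment
  under the history \<open>h\<close>.\<close>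

definition past :: "nat \<Rightarrow> nat \<Rightarrow> nat \<Rightarrow> (nat \<times> nat) set" where
  "past k j t = {(i, s). i < k \<and> (s \<le> t \<or> s = Suc t \<and> i < j)}"

definition current :: "nat \<Rightarrow> nat \<Rightarrow> nat \<Rightarrow> (nat \<Rightarrow> nat \<Rightarrow> 'v) \<Rightarrow> nat \<Rightarrow> 'v" where
  "current k j t h = (\<lambda>i\<in>{..<k}. if i < j then h i (Suc t) else h i t)"

text \<open>The kernel \<open>\<kappa>\<close> depends on the walker \<open>j\<close> whose turn it is, but not on the time \<open>t\<close>.\<close>

definition markovian :: "'w measure \<Rightarrow> nat \<Rightarrow> (nat \<Rightarrow> nat \<Rightarrow> 'w \<Rightarrow> 'v) \<Rightarrow> bool" where
  "markovian M k X \<longleftrightarrow>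
     (\<exists>\<kappa> :: nat \<Rightarrow> (nat \<Rightarrow> 'v) \<Rightarrow> 'v pmf. \<forall>j<k. \<forall>t h.
        \<P>(\<omega> in M. \<forall>(i, s)\<in>past k j t. X i s \<omega> = h i s) > 0 \<longrightarrow>
        (\<forall>y. \<P>(\<omega> in M. X j (Suc t) \<omega> = y \<bar> \<forall>(i, s)\<in>past k j t. X i s \<omega> = h i s) =
             pmf (\<kappa> j (current k j t h)) y))"

definition markovian_avoidance_coupling ::
    "'w measure \<Rightarrow> nat \<Rightarrow> 'v set \<Rightarrow> ('v \<Rightarrow> 'v set) \<Rightarrow> (nat \<Rightarrow> nat \<Rightarrow> 'w \<Rightarrow> 'v) \<Rightarrow> bool" where
  "markovian_avoidance_coupling M k V N X \<longleftrightarrow>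
     coupling M k V N X \<and> avoiding M k X \<and> markovian M k X"

end

theory Submission
  imports Defs "HOL-Library.Nat_Bijection"
begin

text \<open>
The vertices are the residues modulo \<open>n\<close>. Choose \<open>d\<close> with \<open>k \<le> 2 ^ d\<close> and write
\<open>i\<^sub>1, \<dots>, i\<^sub>d\<close> for the binary digits of the walker \<open>i\<close>, least significant first. At the end of every
round the walkers are arranged as \<open>X\<^sub>i = C + \<Sum>\<^sub>l i\<^sub>l g\<^sub>l\<close> with a common origin \<open>C\<close> and common
\<open>g\<^sub>l \<in> {2 ^ (l - 1), - 2 ^ (l - 1)}\<close>. In a round the signs of the \<open>g\<^sub>l\<close> are redrawn, giving \<open>g'\<^sub>l\<close>, and the
origin moves by \<open>h + \<Sum>\<^sub>l g\<^sub>l\<close>. Then walker \<open>i\<close> is displaced by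
  \<open>h + \<Sum>\<^sub>l (i\<^sub>l g'\<^sub>l + (1 - i\<^sub>l) g\<^sub>l)\<close>.
So every walker sees a sum of the same shape, and each sign that is ever drawn enters the
displacements of a fixed walker at most once: when it is drawn if \<open>i\<^sub>l = 1\<close>, and when it is replaced if
\<open>i\<^sub>l = 0\<close>. Hence each walker, viewed alone, makes independent displacements, all with the law of
\<open>h + \<Sum>\<^sub>l g\<^sub>l\<close>. If \<open>h\<close> takes two consecutive values with equal probability, this law is uniform on
\<open>2 ^ (d + 1)\<close> consecutive integers. A mixture of such laws is uniform on all displacements
\<open>0, \<dots>, n - 1\<close> (for \<open>K\<^sub>n\<^sup>*\<close>) or \<open>1, \<dots>, n - 1\<close> (for \<open>K\<^sub>n\<close>), as long as intervals of this length tile that range.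

Two walkers are never at the same place at the end of a round, since a sum of distinct powers of two with
arbitrary signs does not vanish. If \<open>i < j\<close> and \<open>l\<close> is the most significant digit in which
they differ, then the displacement of \<open>i\<close> contains the old sign of \<open>g\<^sub>l\<close>, which also decides
on which side of \<open>i\<close> the walker \<open>j\<close> is found. This makes the displacement too large, or of the wrong sign, to carry
\<open>i\<close> to the place of \<open>j\<close> (\<open>no_collision\<close>).

Intervals of length \<open>2 ^ (d + 1)\<close> need not tile the range of displacements. The remainder is cut
according to its binary digits into intervals of length \<open>2 ^ p\<close> with \<open>p \<le> d\<close>, on which only the signs of
\<open>g\<^sub>1, \<dots>, g\<^sub>p\<^sub>-\<^sub>1\<close> are redrawn and the others are kept. A walker that is about to move must be able to tell from the
current positions alone whether a sign is kept, and if so what it is. This works because the shorter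
intervals are separated by full ones (\<open>frozen_level_visible\<close>). One full
interval for each binary digit accounts for the logarithm in the bound on \<open>k\<close> (\<open>tiling_exists\<close>).

The displacement of the last of \<open>2 ^ d\<close> walkers encodes everything that is random in a round, so a round is
driven by one uniform number \<open>z\<close>. For a fixed walker, \<open>z\<close> and the signs that it has not met yet are
mapped to its displacement and its new unmet signs by an involution
(\<open>exchange_involution\<close>), from which independence and uniformity are derived. The coupling is
Markovian because the law of the next move, given all \<open>z\<close> that are compatible with the past, is a
function of the current positions (\<open>move_law_unique\<close>).
\<close>

section \<open>Binary codes of finite sets\<close>

lemma set_encode_less_power:
  assumes "A \<subseteq> {..<m}"
  shows "set_encode A < 2 ^ m"
proof -
  have "set_encode A \<le> (\<Sum>l<m. 2 ^ l)"
    unfolding set_encode_def using assms by (intro sum_mono2) auto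
  also have "\<dots> < 2 ^ m"
    by (induction m) auto
  finally show ?thesis .
qed

lemma power_le_set_encode:
  assumes "finite A" "l \<in> A"
  shows "2 ^ l \<le> set_encode A"
  unfolding set_encode_def using assms by (intro member_le_sum) auto

lemma set_encode_Un_disjoint:
  assumes "finite A" "finite B" "A \<inter> B = {}"
  shows "set_encode (A \<union> B) = set_encode A + set_encode B"
  unfolding set_encode_def using assms by (rule sum.union_disjoint)

lemma set_encode_split:
  assumes "finite A"
  shows "set_encode A = set_encode (A \<inter> B) + set_encode (A - B)"
proof -
  have "set_encode ((A \<inter> B) \<union> (A - B)) = set_encode (A \<inter> B) + set_encode (A - B)"
    by (rule set_encode_Un_disjoint) (use assms in auto)
  then show ?thesis by (simp only: Int_Diff_Un)
qed

lemma set_decode_subset: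
  assumes "m < 2 ^ r"
  shows "set_decode m \<subseteq> {..<r}"
proof
  fix l assume "l \<in> set_decode m"
  then have "(2::nat) ^ l \<le> m"
    using power_le_set_encode[of "set_decode m" l] by simp
  with assms have "(2::nat) ^ l < 2 ^ r" by linarith
  then show "l \<in> {..<r}" by simp
qed

text \<open>Binary numbers are compared at the most significant digit in which they differ.\<close>

lemma set_encode_less_witness:
  assumes "finite A" "finite B" "set_encode A < set_encode B"
  obtains x where "x \<in> B - A" "A \<inter> {x<..} = B \<inter> {x<..}"
proof -
  define D where "D = (A - B) \<union> (B - A)"
  have "D \<noteq> {}" using assms(3) by (auto simp: D_def)
  have "finite D" using assms by (simp add: D_def)
  define x where "x = Max D"
  have xD: "x \<in> D" using \<open>D \<noteq> {}\<close> \<open>finite D\<close> by (simp add: x_def)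
  have above: "A \<inter> {x<..} = B \<inter> {x<..}"
  proof -
    have "y \<notin> D" if "y > x" for y
      using that Max_ge[OF \<open>finite D\<close>, of y] by (auto simp: x_def)
    then show ?thesis by (auto simp: D_def)
  qed
  have "x \<notin> A - B"
  proof
    assume "x \<in> A - B"
    have "set_encode B = set_encode (B \<inter> {x<..}) + set_encode (B - {x<..})"
      using assms(2) by (rule set_encode_split)
    also have "B - {x<..} \<subseteq> {..<x}" using \<open>x \<in> A - B\<close> by (auto simp: not_less le_less)
    then have "set_encode (B - {x<..}) < 2 ^ x" by (rule set_encode_less_power)
    moreover have "2 ^ x \<le> set_encode (A - {x<..})"
      using \<open>x \<in> A - B\<close> assms(1) by (intro power_le_set_encode) auto
    moreover have "set_encode A = set_encode (A \<inter> {x<..}) + set_encode (A - {x<..})"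
      using assms(1) by (rule set_encode_split)
    ultimately show False using assms(3) above by simp
  qed
  with xD above that show ?thesis by (auto simp: D_def)
qed

section \<open>Tiling the displacements by blocks\<close>

text \<open>The displacements are \<open>{a..<n}\<close>. A displacement \<open>z\<close> lies in the block that begins at \<open>start z\<close> and
has length \<open>2 ^ Suc (level z)\<close>; a round with this displacement redraws the signs at the levels
\<open>1, \<dots>, level z\<close>. At level \<open>0\<close> no sign is redrawn and a block may be a single point, which is why
\<open>block\<close> speaks of positive levels only. Blocks that do not redraw all signs avoid both ends of the range, where a small
displacement could hit another walker (\<open>partial\<close>). If the sign at level \<open>l\<close> is kept but unknown,
then a displacement can be read from the positions only up to \<open>2 ^ l\<close>; \<open>isolated\<close> removes this ambiguity.\<close>

locale tiling =
  fixes n d a :: nat and start level :: "nat \<Rightarrow> nat"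
  assumes a: "a \<le> 1"
    and n: "2 ^ d < n"
    and start: "\<And>z. z \<in> {a..<n} \<Longrightarrow> start z \<le> z \<and> z < start z + 2 ^ Suc (level z)"
    and level: "\<And>z. z \<in> {a..<n} \<Longrightarrow> level z \<le> d"
    and block: "\<And>z w. z \<in> {a..<n} \<Longrightarrow> level z > 0 \<Longrightarrow> start z \<le> w \<Longrightarrow> w < start z + 2 ^ Suc (level z) \<Longrightarrow>
       w \<in> {a..<n} \<and> start w = start z \<and> level w = level z"
    and partial: "\<And>z. z \<in> {a..<n} \<Longrightarrow> level z < d \<Longrightarrow> 2 ^ d \<le> z \<and> z \<le> n - 2 ^ d"
    and isolated: "\<And>z w l. z \<in> {a..<n} \<Longrightarrow> w \<in> {a..<n} \<Longrightarrow> level z < l \<Longrightarrow> level w < l \<Longrightarrow> l \<le> d \<Longrightarrow>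
       z \<noteq> w + 2 ^ l"

lemma tiling_zero:
  assumes "a \<le> 1" "2 \<le> n"
  shows "tiling n 0 a (\<lambda>z. z) (\<lambda>_. 0)"
proof
  show "2 ^ 0 < n" using assms by simp
qed (use assms in simp_all)

text \<open>With \<open>R\<close> the remainder of the number of displacements modulo the full block length \<open>B\<close>, the
range is cut into units: unit \<open>p\<close> consists of a full block followed by an interval of length \<open>2 ^ p\<close> if the
binary digit \<open>p\<close> of \<open>R\<close> is \<open>1\<close>, and of a full block only otherwise. Unit \<open>p\<close> begins at \<open>S p\<close>. There are
at least \<open>d + 2\<close> units, one for each digit of \<open>R\<close> and a last one that is a full block.\<close>

lemma tiling_exists:
  fixes n d a :: nat
  assumes a: "a \<le> 1" and d: "d \<ge> 1" and n: "(d + 2) * 2 ^ Suc d \<le> n - a"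
  obtains start level where "tiling n d a start level"
proof -
  define B :: nat where "B = 2 ^ Suc d"
  define R where "R = (n - a) mod B"
  define q where "q = (n - a) div B"
  define S where "S p = a + p * B + R mod 2 ^ p" for p
  define r where "r p = S (Suc p) - (S p + B)" for p
  have B0: "B > 0" by (simp add: B_def)
  have RB: "R < B" by (simp add: R_def B0)
  have q: "q \<ge> d + 2"
  proof -
    have "((d + 2) * B) div B \<le> (n - a) div B"
      using n unfolding B_def by (rule div_le_mono)
    then show ?thesis using B0 unfolding q_def by (simp only: nonzero_mult_div_cancel_right)
  qed
  have modSuc': "R mod 2 ^ Suc p = R mod 2 ^ p + 2 ^ p * (R div 2 ^ p mod 2)" for p
    using mod_mult2_eq[of R "2 ^ p" 2] by (simp only: power_Suc mult.commute[of 2] add.commute)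
  have modSuc: "R mod 2 ^ Suc p = R mod 2 ^ p \<or> R mod 2 ^ Suc p = R mod 2 ^ p + 2 ^ p" for p
  proof -
    have "R div 2 ^ p mod 2 = 0 \<or> R div 2 ^ p mod 2 = 1" by linarith
    then show ?thesis using modSuc'[of p] by (elim disjE) (simp_all only: mult_0_right mult_1_right add_0_right simp_thms)
  qed
  have mod_full: "R mod 2 ^ p = R" if "p \<ge> Suc d" for p
  proof -
    have "B \<le> 2 ^ p" unfolding B_def using that by (intro power_increasing) auto
    then show ?thesis using RB by simp
  qed
  have S_step: "S p + B \<le> S (Suc p)" "S (Suc p) \<le> S p + B + 2 ^ p" for p
    using modSuc[of p] unfolding S_def by (auto simp del: power_Suc)
  have S_full: "S (Suc p) = S p + B" if "p \<ge> Suc d" for p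
    using that mod_full[of p] mod_full[of "Suc p"] by (simp add: S_def del: power_Suc)
  have S_mono: "S p + B \<le> S p'" if "p < p'" for p p'
    using that
  proof (induction p')
    case (Suc p')
    then show ?case using S_step(1)[of p'] by (cases "p = p'") auto
  qed simp
  have Sq: "S q = n"
  proof -
    have "S q = a + (q * B + R)" using q by (simp add: S_def mod_full)
    also have "q * B + R = n - a" by (simp add: q_def R_def)
    also have "a + (n - a) = n"
      using n a by (cases "n - a = 0") auto
    finally show ?thesis .
  qed
  have S0: "S 0 = a" by (simp add: S_def)
  \<comment> \<open>the unit that contains \<open>z\<close>\<close>
  define u where "u z = (LEAST p. z < S (Suc p))" for z
  have u_ex: "z < S (Suc (u z)) \<and> S (u z) \<le> z \<and> u z < q" if z: "z \<in> {a..<n}" for z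
  proof -
    have "q > 0" using q by simp
    then have *: "z < S (Suc (q - 1))" using z Sq by simp
    have 1: "z < S (Suc (u z))" unfolding u_def by (rule LeastI[where P="\<lambda>p. z < S (Suc p)", OF *])
    have 2: "u z \<le> q - 1" unfolding u_def by (rule Least_le[where P="\<lambda>p. z < S (Suc p)", OF *])
    have 3: "S (u z) \<le> z"
    proof (cases "u z")
      case 0
      then show ?thesis using S0 z by simp
    next
      case (Suc p)
      then have "p < (LEAST p. z < S (Suc p))" by (simp add: u_def)
      then have "\<not> z < S (Suc p)" by (rule not_less_Least)
      with Suc show ?thesis by simp
    qed
    from 1 2 3 \<open>q > 0\<close> show ?thesis by auto
  qed
  have u_eq: "u z = p" if "S p \<le> z" "z < S (Suc p)" for z p
    unfolding u_def
  proof (rule Least_equality)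
    fix y assume "z < S (Suc y)"
    show "p \<le> y"
    proof (rule ccontr)
      assume "\<not> p \<le> y"
      then have "Suc y = p \<or> Suc y < p" by auto
      then have "S (Suc y) \<le> S p" using S_mono[of "Suc y" p] by auto
      with \<open>z < S (Suc y)\<close> that show False by simp
    qed
  qed (use that in simp)
  have in_range: "z \<in> {a..<n}" if "S p \<le> z" "z < S (Suc p)" "p < q" for z p
  proof -
    have "S 0 \<le> S p" by (cases "p = 0") (use S_mono[of 0 p] in auto)
    moreover have "S (Suc p) \<le> S q"
      using that(3) S_mono[of "Suc p" q] by (cases "Suc p = q") auto
    ultimately show ?thesis using that S0 Sq by auto
  qed
  define full where "full z \<longleftrightarrow> z < S (u z) + B" for z
  define start where "start z = (if full z then S (u z) else S (u z) + B)" for z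
  define level where "level z = (if full z then d else u z - 1)" for z
  have not_full: "u z \<le> d \<and> S (u z) + B \<le> z \<and> z < S (u z) + B + 2 ^ u z"
    if z: "z \<in> {a..<n}" and nf: "\<not> full z" for z
  proof -
    have 1: "S (u z) + B \<le> z" using nf by (simp add: full_def)
    have "u z \<le> d"
    proof (rule ccontr)
      assume "\<not> u z \<le> d"
      then have "S (Suc (u z)) = S (u z) + B" by (intro S_full) auto
      with 1 u_ex[OF z] show False by simp
    qed
    with 1 u_ex[OF z] S_step(2)[of "u z"] show ?thesis by linarith
  qed
  have "tiling n d a start level"
  proof
    show "a \<le> 1" by fact
    have "(2::nat) ^ d < 2 ^ Suc d" by simp
    moreover have "1 * 2 ^ Suc d \<le> (d + 2) * (2::nat) ^ Suc d" by (rule mult_right_mono) auto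
    ultimately have "(2::nat) ^ d < (d + 2) * 2 ^ Suc d" by (simp only: mult_1)
    with n show "2 ^ d < n" by linarith
    fix z assume z: "z \<in> {a..<n}"
    note uz = u_ex[OF z]
    show "start z \<le> z \<and> z < start z + 2 ^ Suc (level z)"
    proof (cases "full z")
      case True
      then show ?thesis using uz by (simp add: start_def level_def full_def B_def)
    next
      case False
      have "(2::nat) ^ u z \<le> 2 ^ Suc (u z - 1)" by (intro power_increasing) auto
      with not_full[OF z False] False show ?thesis by (simp add: start_def level_def)
    qed
    show lz: "level z \<le> d"
      using not_full[OF z] by (auto simp: level_def)
    show "w \<in> {a..<n} \<and> start w = start z \<and> level w = level z"
      if l0: "level z > 0" and w: "start z \<le> w" "w < start z + 2 ^ Suc (level z)" for w
    proof (cases "full z")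
      case True
      then have w': "S (u z) \<le> w" "w < S (u z) + B" using w by (auto simp: start_def level_def B_def)
      then have w'': "w < S (Suc (u z))" using S_step(1)[of "u z"] by simp
      have "u w = u z" using w'(1) w'' by (rule u_eq)
      then show ?thesis using in_range[OF w'(1) w''] uz True w' by (simp add: start_def level_def full_def)
    next
      case False
      note nf = not_full[OF z False]
      have u2: "u z \<ge> 2" using l0 False by (simp add: level_def)
      then have *: "Suc (level z) = u z" using False by (simp add: level_def)
      \<comment> \<open>the short interval is nonempty, so the digit is \<open>1\<close> and its length is exactly \<open>2 ^ u z\<close>\<close>
      have Seq: "S (Suc (u z)) = S (u z) + B + 2 ^ u z"
      proof -
        have "S (u z) + B < S (Suc (u z))" using uz nf by linarith
        moreover note modSuc[of "u z"]
        ultimately show ?thesis unfolding S_def by (auto simp del: power_Suc)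
      qed
      have w': "S (u z) + B \<le> w" "w < S (Suc (u z))" using w False Seq * by (auto simp: start_def)
      then have "S (u z) \<le> w" by simp
      then have "u w = u z" using w'(2) by (rule u_eq)
      then show ?thesis
        using in_range[OF \<open>S (u z) \<le> w\<close> w'(2)] uz False w' by (simp add: start_def level_def full_def)
    qed
    show "2 ^ d \<le> z \<and> z \<le> n - 2 ^ d" if "level z < d"
    proof -
      have "\<not> full z" using that by (auto simp: level_def)
      note nf = not_full[OF z this]
      have "(2::nat) ^ d \<le> B" by (simp add: B_def)
      moreover have "S (Suc (u z)) + B \<le> n"
        using S_mono[of "Suc (u z)" q] nf q Sq by auto
      ultimately show ?thesis using uz nf by linarith
    qed
    show "z \<noteq> w + 2 ^ l"
      if w: "w \<in> {a..<n}" and l: "level z < l" "level w < l" "l \<le> d" for w l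
    proof
      assume eq: "z = w + 2 ^ l"
      have nfz: "\<not> full z" "\<not> full w" using l by (auto simp: level_def)
      note nf = not_full[OF z nfz(1)] not_full[OF w nfz(2)]
      \<comment> \<open>both points lie in short intervals: in the same one they are too close, in different ones too far apart\<close>
      have lB: "(2::nat) ^ l < B" unfolding B_def using l(3) by (intro power_strict_increasing) auto
      consider "u z = u w" | "u z < u w" | "u w < u z" by linarith
      then show False
      proof cases
        case 1
        have "u z \<le> l" using l nfz by (simp add: level_def)
        then have "(2::nat) ^ u z \<le> 2 ^ l" by (intro power_increasing) auto
        moreover have "S (u z) = S (u w)" using 1 by simp
        ultimately show False using nf eq by linarith
      next
        case 2
        then have "S (Suc (u z)) \<le> S (u w)"
          using S_mono[of "Suc (u z)" "u w"] by (cases "Suc (u z) = u w") auto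
        with uz nf eq show False by linarith
      next
        case 3
        then have "S (Suc (u w)) \<le> S (u z)"
          using S_mono[of "Suc (u w)" "u z"] by (cases "Suc (u w) = u z") auto
        with u_ex[OF w] nf eq lB show False by linarith
      qed
    qed
  qed
  then show ?thesis by (rule that)
qed

section \<open>Arrangement and displacement of the walkers\<close>

text \<open>The digits of a walker are numbered from \<open>1\<close>, like the signs; the factor \<open>2\<close> causes the shift. The number \<open>0\<close>
is left free for the lowest digit of the offset of a displacement in its block, which selects one of the two
consecutive values of \<open>h\<close>.\<close>

definition bits :: "nat \<Rightarrow> nat set" where
  "bits i = set_decode (2 * i)"

lemma finite_bits [simp]: "finite (bits i)"
  by (simp add: bits_def)

lemma set_encode_bits: "set_encode (bits i) = 2 * i"
  by (simp add: bits_def)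

lemma bits_0 [simp]: "bits 0 = {}"
  by (simp add: bits_def)

lemma bits_subset:
  assumes "i < 2 ^ d"
  shows "bits i \<subseteq> {1..d}"
proof -
  have "bits i \<subseteq> {..<Suc d}"
    unfolding bits_def by (rule set_decode_subset) (use assms in simp)
  moreover have "0 \<notin> bits i"
    by (simp add: bits_def)
  ultimately have "l \<in> {1..d}" if "l \<in> bits i" for l
    using that by (cases l) auto
  then show ?thesis by blast
qed

lemma bits_power: "l \<ge> 1 \<Longrightarrow> bits (2 ^ (l - 1)) = {l}"
proof -
  assume "l \<ge> 1"
  then have "2 * 2 ^ (l - 1) = set_encode {l}" by (cases l) simp_all
  then show ?thesis unfolding bits_def by (simp only: set_encode_inverse finite.intros)
qed

text \<open>This is \<open>\<Sum>\<^sub>l i\<^sub>l g\<^sub>l\<close>, where \<open>g\<^sub>l\<close> is positive exactly if \<open>l \<in> G\<close>: the set \<open>G\<close> contributes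
\<open>2 ^ l\<close> for each positive sign, and \<open>i\<close> is the sum of \<open>2 ^ (l - 1)\<close> over the digits of \<open>i\<close>.\<close>

definition offset :: "nat set \<Rightarrow> nat \<Rightarrow> int" where
  "offset G i = int (set_encode (G \<inter> bits i)) - int i"

lemma offset_0 [simp]: "offset G 0 = 0"
  by (simp add: offset_def)

lemma offset_power:
  assumes "l \<ge> 1"
  shows "offset G (2 ^ (l - 1)) = (if l \<in> G then 2 ^ (l - 1) else - (2 ^ (l - 1)))"
proof -
  have "offset G (2 ^ (l - 1)) = int (set_encode (G \<inter> {l})) - 2 ^ (l - 1)"
    by (simp only: offset_def bits_power[OF assms] of_nat_power of_nat_numeral)
  moreover have "(2::int) ^ l = 2 * 2 ^ (l - 1)" using assms by (cases l) auto
  ultimately show ?thesis by (cases "l \<in> G") simp_all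
qed

lemma offset_double:
  "2 * offset G i = int (set_encode (bits i \<inter> G)) - int (set_encode (bits i - G))"
  using set_encode_split[OF finite_bits, of i G] set_encode_bits[of i]
  by (simp add: offset_def Int_commute)

lemma offset_sum: "offset G i = (\<Sum>l\<in>bits i. offset G (2 ^ (l - 1)))"
proof -
  have pos: "l \<ge> 1" if "l \<in> bits i" for l
    using that by (cases l) (auto simp: bits_def)
  have "2 * (\<Sum>l\<in>bits i. offset G (2 ^ (l - 1))) = (\<Sum>l\<in>bits i. if l \<in> G then 2 ^ l else - (2 ^ l))"
    unfolding sum_distrib_left
  proof (rule sum.cong)
    fix l assume "l \<in> bits i"
    then have "l \<ge> 1" by (rule pos)
    then show "2 * offset G (2 ^ (l - 1)) = (if l \<in> G then 2 ^ l else - (2 ^ l))"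
      by (cases l) (simp_all add: offset_power[of l] offset_power[of "Suc _", simplified])
  qed simp
  also have "\<dots> = (\<Sum>l\<in>bits i \<inter> G. 2 ^ l) + (\<Sum>l\<in>bits i - G. - (2 ^ l))"
    by (subst sum.If_cases) (auto simp: Diff_eq Collect_neg_eq)
  also have "\<dots> = 2 * offset G i"
    by (simp add: offset_double set_encode_def sum_negf)
  finally show ?thesis by simp
qed

text \<open>The most significant digit in which \<open>i\<close> and \<open>j\<close> differ dominates: its sign decides the sign of the
difference of the offsets.\<close>

lemma offset_diff:
  assumes "i < j"
  shows "\<exists>x \<in> bits j - bits i.
    (x \<in> G \<longrightarrow> 0 < offset G j - offset G i \<and> offset G j - offset G i < 2 ^ x) \<and>
    (x \<notin> G \<longrightarrow> - (2 ^ x) < offset G j - offset G i \<and> offset G j - offset G i < 0)"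
proof -
  have "set_encode (bits i) < set_encode (bits j)"
    using assms by (simp add: set_encode_bits)
  then obtain x where x: "x \<in> bits j - bits i" and above: "bits i \<inter> {x<..} = bits j \<inter> {x<..}"
    using set_encode_less_witness[of "bits i" "bits j"] by auto
  have split: "set_encode A = set_encode (A \<inter> {x<..}) + set_encode (A \<inter> {x}) + set_encode (A \<inter> {..<x})"
    if "finite A" for A :: "nat set"
  proof -
    have "set_encode A = set_encode (A \<inter> {x<..}) + set_encode (A - {x<..})"
      using that by (rule set_encode_split)
    also have "set_encode (A - {x<..}) = set_encode ((A - {x<..}) \<inter> {x}) + set_encode (A - {x<..} - {x})"
      using that by (intro set_encode_split) simp
    also have "(A - {x<..}) \<inter> {x} = A \<inter> {x}" by auto
    also have "A - {x<..} - {x} = A \<inter> {..<x}" by auto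
    finally show ?thesis by simp
  qed
  define plus where "plus = set_encode (bits j \<inter> G \<inter> {..<x}) + set_encode ((bits i - G) \<inter> {..<x})"
  define minus where "minus = set_encode (bits i \<inter> G \<inter> {..<x}) + set_encode ((bits j - G) \<inter> {..<x})"
  have "plus = set_encode (bits j \<inter> G \<inter> {..<x} \<union> (bits i - G) \<inter> {..<x})"
    unfolding plus_def by (rule set_encode_Un_disjoint[symmetric]) auto
  also have "\<dots> < 2 ^ x" by (rule set_encode_less_power) auto
  finally have plus: "int plus < 2 ^ x" by simp
  have "minus = set_encode (bits i \<inter> G \<inter> {..<x} \<union> (bits j - G) \<inter> {..<x})"
    unfolding minus_def by (rule set_encode_Un_disjoint[symmetric]) auto
  also have "\<dots> < 2 ^ x" by (rule set_encode_less_power) auto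
  finally have minus: "int minus < 2 ^ x" by simp
  have sgn: "int (set_encode (bits j \<inter> G \<inter> {x})) - int (set_encode ((bits j - G) \<inter> {x})) =
      (if x \<in> G then 2 ^ x else - (2 ^ x))"
  proof (cases "x \<in> G")
    case True
    then have "bits j \<inter> G \<inter> {x} = {x}" "(bits j - G) \<inter> {x} = {}" using x by auto
    then show ?thesis using True by simp
  next
    case False
    then have "bits j \<inter> G \<inter> {x} = {}" "(bits j - G) \<inter> {x} = {x}" using x by auto
    then show ?thesis using False by simp
  qed
  have i0: "bits i \<inter> G \<inter> {x} = {}" "(bits i - G) \<inter> {x} = {}" using x by auto
  have hi: "bits i \<inter> G \<inter> {x<..} = bits j \<inter> G \<inter> {x<..}" "(bits i - G) \<inter> {x<..} = (bits j - G) \<inter> {x<..}"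
    using above by auto
  have key: "2 * (offset G j - offset G i) = (if x \<in> G then 2 ^ x else - (2 ^ x)) + int plus - int minus"
    unfolding sgn[symmetric] right_diff_distrib offset_double plus_def minus_def
    using split[of "bits j \<inter> G"] split[of "bits j - G"] split[of "bits i \<inter> G"] split[of "bits i - G"]
    by (simp add: i0 hi)
  have nonneg: "0 \<le> int plus" "0 \<le> int minus" by simp_all
  have arith: "2 * u = P + p - m \<Longrightarrow> p < P \<Longrightarrow> m < P \<Longrightarrow> 0 \<le> p \<Longrightarrow> 0 \<le> m \<Longrightarrow> 0 < u \<and> u < P"
    "2 * u = - P + p - m \<Longrightarrow> p < P \<Longrightarrow> m < P \<Longrightarrow> 0 \<le> p \<Longrightarrow> 0 \<le> m \<Longrightarrow> - P < u \<and> u < 0"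
    for u P p m :: int by auto
  have "0 < offset G j - offset G i \<and> offset G j - offset G i < 2 ^ x" if "x \<in> G"
    by (rule arith(1)[OF _ plus minus nonneg]) (simp only: key that if_True)
  moreover have "- (2 ^ x) < offset G j - offset G i \<and> offset G j - offset G i < 0" if "x \<notin> G"
    by (rule arith(2)[OF _ plus minus nonneg]) (simp only: key that if_False not_False_eq_True simp_thms)
  ultimately show ?thesis using x by blast
qed

context tiling
begin

text \<open>The offset of a displacement in its block, read in binary: digit \<open>0\<close> is the parity, and the digits
\<open>1, \<dots>, level z\<close> are the fresh signs.\<close>

definition signs :: "nat \<Rightarrow> nat set" where
  "signs z = set_decode (z - start z)"

text \<open>The displacement of the walker with digit set \<open>B\<close>. At the redrawn levels it uses the fresh sign at its own digits
and the old sign elsewhere.\<close>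

definition jump :: "nat set \<Rightarrow> nat \<Rightarrow> nat set \<Rightarrow> nat" where
  "jump B z G = start z + set_encode ((signs z - ({1..level z} - B)) \<union> (G \<inter> {1..level z} - B))"

definition redraw :: "nat \<Rightarrow> nat set \<Rightarrow> nat set" where
  "redraw z G = (signs z \<inter> {1..level z}) \<union> (G - {1..level z})"

lemma finite_signs [simp]: "finite (signs z)"
  by (simp add: signs_def)

lemma signs_subset: "z \<in> {a..<n} \<Longrightarrow> signs z \<subseteq> {..level z}"
  using start[of z] set_decode_subset[of "z - start z" "Suc (level z)"]
  unfolding signs_def lessThan_Suc_atMost by linarith

lemma start_plus_encode: "z \<in> {a..<n} \<Longrightarrow> start z + set_encode (signs z) = z"
  using start[of z] by (simp add: signs_def)

text \<open>A block of positive level contains every pattern of redrawn signs; at level \<open>0\<close> the only pattern admitted is that of \<open>z\<close>.\<close>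

lemma same_block:
  assumes z: "z \<in> {a..<n}" and W: "W \<subseteq> {..level z}" "W - {1..level z} = signs z - {1..level z}"
  defines "w \<equiv> start z + set_encode W"
  shows "w \<in> {a..<n}" "start w = start z" "level w = level z" "signs w = W"
proof -
  have fin: "finite W" using W(1) by (rule finite_subset) simp
  have *: "w \<in> {a..<n} \<and> start w = start z \<and> level w = level z"
  proof (cases "level z > 0")
    case True
    have "set_encode W < 2 ^ Suc (level z)"
      by (rule set_encode_less_power) (use W(1) in \<open>simp add: lessThan_Suc_atMost\<close>)
    then show ?thesis
      using block[OF z True, of w] by (simp add: w_def)
  next
    case False
    then have "W = signs z" using W(2) by simp
    then have "w = z" using start_plus_encode[OF z] by (simp add: w_def)
    then show ?thesis using z by simp
  qed
  then show "w \<in> {a..<n}" "start w = start z" "level w = level z" by auto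
  show "signs w = W"
    using * fin by (simp add: signs_def) (simp add: w_def)
qed

lemma jump_block:
  assumes z: "z \<in> {a..<n}"
  shows "jump B z G \<in> {a..<n}" "start (jump B z G) = start z" "level (jump B z G) = level z"
    "signs (jump B z G) = (signs z - ({1..level z} - B)) \<union> (G \<inter> {1..level z} - B)"
proof -
  let ?W = "(signs z - ({1..level z} - B)) \<union> (G \<inter> {1..level z} - B)"
  have W: "?W \<subseteq> {..level z}" "?W - {1..level z} = signs z - {1..level z}"
    using signs_subset[OF z] by auto
  show "jump B z G \<in> {a..<n}" "start (jump B z G) = start z" "level (jump B z G) = level z" "signs (jump B z G) = ?W"
    unfolding jump_def by (rule same_block[OF z W])+
qed

lemma redraw_subset: "G \<subseteq> {1..d} \<Longrightarrow> z \<in> {a..<n} \<Longrightarrow> redraw z G \<subseteq> {1..d}"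
  using level[of z] by (auto simp: redraw_def)

text \<open>The displacement of walker \<open>0\<close>, which the origin shares, contains all old signs at the redrawn levels. For
walker \<open>i\<close> the change of the arrangement cancels those at its digits and puts the fresh ones in their place.\<close>

lemma displacement:
  assumes "finite G"
  shows "int (jump {} z G) + offset (redraw z G) i = offset G i + int (jump (bits i) z G)"
proof -
  let ?B = "bits i" and ?I = "{1..level z}"
  have 1: "set_encode (redraw z G \<inter> ?B) = set_encode (signs z \<inter> ?I \<inter> ?B) + set_encode ((G - ?I) \<inter> ?B)"
    unfolding redraw_def by (subst set_encode_Un_disjoint[symmetric])
      (use assms in \<open>auto simp: Int_Un_distrib2\<close>)
  have 2: "set_encode ((signs z - (?I - {})) \<union> (G \<inter> ?I - {})) =
      set_encode (signs z - ?I) + (set_encode (G \<inter> ?I \<inter> ?B) + set_encode (G \<inter> ?I - ?B))"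
    using set_encode_Un_disjoint[of "signs z - ?I" "G \<inter> ?I"] set_encode_split[of "G \<inter> ?I" ?B] assms
    by (simp add: disjoint_iff)
  have 3: "set_encode (G \<inter> ?B) = set_encode (G \<inter> ?I \<inter> ?B) + set_encode ((G - ?I) \<inter> ?B)"
    by (subst set_encode_Un_disjoint[symmetric])
      (use assms in \<open>auto intro!: arg_cong[where f=set_encode]\<close>)
  have 4: "set_encode ((signs z - (?I - ?B)) \<union> (G \<inter> ?I - ?B)) =
      set_encode (signs z - ?I) + set_encode (signs z \<inter> ?I \<inter> ?B) + set_encode (G \<inter> ?I - ?B)"
  proof -
    have "set_encode (signs z - (?I - ?B)) = set_encode (signs z - ?I) + set_encode (signs z \<inter> ?I \<inter> ?B)"
      by (subst set_encode_Un_disjoint[symmetric])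
        (auto intro!: arg_cong[where f=set_encode])
    moreover have "set_encode ((signs z - (?I - ?B)) \<union> (G \<inter> ?I - ?B)) =
      set_encode (signs z - (?I - ?B)) + set_encode (G \<inter> ?I - ?B)"
      by (rule set_encode_Un_disjoint) (use assms in auto)
    ultimately show ?thesis by simp
  qed
  show ?thesis
    unfolding jump_def offset_def 1 2 3 4 by simp
qed

definition pos :: "int \<Rightarrow> nat set \<Rightarrow> nat \<Rightarrow> nat" where
  "pos c G i = nat ((c + offset G i) mod int n)"

lemma n_pos: "n > 0"
  using n by simp

lemma pos_less: "pos c G i < n"
  using n_pos by (simp add: pos_def nat_less_iff)

lemma pos_int: "int (pos c G i) = (c + offset G i) mod int n"
  using n_pos by (simp add: pos_def)

lemma pos_eq_iff: "pos c G i = pos c' G' j \<longleftrightarrow> int n dvd (c + offset G i) - (c' + offset G' j)"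
  by (simp add: of_nat_eq_iff[symmetric, where ?'a=int] pos_int mod_eq_dvd_iff del: of_nat_eq_iff)

definition moved :: "int \<Rightarrow> nat set \<Rightarrow> nat \<Rightarrow> nat \<Rightarrow> nat" where
  "moved c G z i = pos (c + int (jump {} z G)) (redraw z G) i"

lemma moved_eq_iff:
  assumes "finite G"
  shows "moved c G z i = pos c' G' j \<longleftrightarrow> int n dvd (c + offset G i + int (jump (bits i) z G)) - (c' + offset G' j)"
proof -
  have "c + int (jump {} z G) + offset (redraw z G) i = c + offset G i + int (jump (bits i) z G)"
    using displacement[OF assms, of z i] by simp
  then show ?thesis by (simp only: moved_def pos_eq_iff)
qed

lemma no_dvd_small: "\<bar>x\<bar> < int n \<Longrightarrow> x \<noteq> 0 \<Longrightarrow> \<not> int n dvd x"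
  using dvd_imp_le_int[of x "int n"] by auto

lemma small_diff:
  assumes "i < j" "j < 2 ^ d"
  shows "offset G j \<noteq> offset G i" "\<bar>offset G j - offset G i\<bar> < 2 ^ d"
proof -
  obtain x where x: "x \<in> bits j - bits i"
    "x \<in> G \<Longrightarrow> 0 < offset G j - offset G i \<and> offset G j - offset G i < 2 ^ x"
    "x \<notin> G \<Longrightarrow> - (2 ^ x) < offset G j - offset G i \<and> offset G j - offset G i < 0"
    using offset_diff[OF assms(1), of G] by blast
  have "x \<le> d" using x(1) bits_subset[OF assms(2)] by auto
  then have "(2::int) ^ x \<le> 2 ^ d" by (rule power_increasing) simp
  with x(2,3) show "offset G j \<noteq> offset G i" "\<bar>offset G j - offset G i\<bar> < 2 ^ d"
    by (cases "x \<in> G"; linarith)+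
qed

lemma n_int: "(2::int) ^ d < int n"
  using n by (metis of_nat_less_iff of_nat_numeral of_nat_power)

lemma distinct_positions:
  assumes "i \<noteq> j" "i < 2 ^ d" "j < 2 ^ d"
  shows "pos c G i \<noteq> pos c G j"
proof -
  have "\<not> int n dvd offset G i - offset G j"
  proof (cases "i < j")
    case True
    then show ?thesis
      using small_diff[OF True assms(3), of G] n_int by (intro no_dvd_small) linarith+
  next
    case False
    then have "j < i" using assms by simp
    then show ?thesis
      using small_diff[OF _ assms(2), of j G] n_int by (intro no_dvd_small) linarith+
  qed
  then show ?thesis by (simp add: pos_eq_iff)
qed

text \<open>Let \<open>x\<close> be the most significant digit in which \<open>i\<close> and \<open>j\<close> differ. In a full block the displacement of \<open>i\<close>
uses the old sign at \<open>x\<close>. If it is positive, the displacement is at least \<open>2 ^ x\<close>, more than the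
distance from \<open>i\<close> up to \<open>j\<close>; if it is negative, then \<open>j\<close> is below \<open>i\<close> by less than \<open>2 ^ x\<close>, and the
displacement stays more than \<open>2 ^ x\<close> short of a full turn. In the other blocks the displacement exceeds every
distance between two walkers in both directions.\<close>

lemma no_collision:
  assumes ij: "i < j" "j < 2 ^ d" and G: "G \<subseteq> {1..d}" and z: "z \<in> {a..<n}"
  shows "moved c G z i \<noteq> pos c G j"
proof
  assume "moved c G z i = pos c G j"
  have fin: "finite G" using G by (rule finite_subset) simp
  define w where "w = jump (bits i) z G"
  define \<Delta> where "\<Delta> = offset G j - offset G i"
  note w = jump_block[OF z, of "bits i" G, folded w_def]
  have dvd: "int n dvd int w - \<Delta>"
    using \<open>moved c G z i = pos c G j\<close> moved_eq_iff[OF fin, of c z i c G j]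
    by (simp add: w_def \<Delta>_def algebra_simps)
  obtain x where x: "x \<in> bits j - bits i"
    "x \<in> G \<Longrightarrow> 0 < \<Delta> \<and> \<Delta> < 2 ^ x" "x \<notin> G \<Longrightarrow> - (2 ^ x) < \<Delta> \<and> \<Delta> < 0"
    unfolding \<Delta>_def using offset_diff[OF ij(1), of G] by blast
  have xd: "x \<in> {1..d}" using x(1) bits_subset[OF ij(2)] by auto
  have small: "\<bar>\<Delta>\<bar> < 2 ^ d" unfolding \<Delta>_def by (rule small_diff(2)[OF ij])
  have "w < n" using w(1) by simp
  have "int w - \<Delta> = 0 \<or> int w - \<Delta> = int n"
  proof -
    obtain q where q: "int w - \<Delta> = int n * q" using dvd by (auto elim: dvdE)
    have "- int n < int n * q" "int n * q < 2 * int n"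
      using q small n_int \<open>w < n\<close> by linarith+
    moreover have "int n * 2 \<le> int n * q" if "q \<ge> 2" using that by (intro mult_left_mono) auto
    moreover have "int n * q \<le> int n * (- 1)" if "q \<le> - 1" using that by (intro mult_left_mono) auto
    ultimately have "\<not> q \<ge> 2" "\<not> q \<le> - 1" by linarith+
    then have "q = 0 \<or> q = 1" by auto
    with q show ?thesis by auto
  qed
  moreover have "int w \<noteq> \<Delta> \<and> int w \<noteq> int n + \<Delta>"
  proof (cases "level z = d")
    case True
    have Sw: "signs w = (signs z - ({1..d} - bits i)) \<union> (G - bits i)"
      using w(4) G True by auto
    have wenc: "w = start z + set_encode (signs w)"
      using start_plus_encode[of w] w by simp
    \<comment> \<open>the last point of the block is a displacement\<close>
    have top: "start z + 2 ^ Suc d \<le> n"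
    proof -
      define r where "r = (2::nat) ^ Suc d - 1"
      have r: "r < 2 ^ Suc (level z)" "Suc r = 2 ^ Suc d" using True by (simp_all add: r_def)
      have "0 < level z" using True xd by simp
      then have "start z + r \<in> {a..<n}" using block[OF z, of "start z + r"] r(1) by simp
      then have "start z + Suc r \<le> n" by simp
      then show ?thesis using r(2) by simp
    qed
    show ?thesis
    proof (cases "x \<in> G")
      case xG: True
      then have "x \<in> signs w" using Sw x(1) by auto
      then have "2 ^ x \<le> set_encode (signs w)" by (intro power_le_set_encode) auto
      then have "2 ^ x \<le> w" using wenc by linarith
      then have "(2::int) ^ x \<le> int w" by (metis of_nat_le_iff of_nat_numeral of_nat_power)
      then show ?thesis using x(2)[OF xG] \<open>w < n\<close> by linarith
    next
      case xG: False
      then have "x \<notin> signs w" using Sw x(1) xd by auto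
      then have "set_encode (insert x (signs w)) = 2 ^ x + set_encode (signs w)" by simp
      moreover have "set_encode (insert x (signs w)) < 2 ^ Suc d"
        using signs_subset[OF w(1)] w(3) True xd by (intro set_encode_less_power) auto
      ultimately have "w + 2 ^ x < n" using wenc top by linarith
      then have "int w + 2 ^ x < int n"
        by (metis of_nat_add of_nat_less_iff of_nat_numeral of_nat_power)
      then show ?thesis using x(3)[OF xG] by linarith
    qed
  next
    case False
    then have "level w < d" using w(3) level[OF z] by simp
    then have "2 ^ d \<le> w" "w \<le> n - 2 ^ d" using partial[OF w(1)] by auto
    then have "w + 2 ^ d \<le> n" using n by linarith
    then have "int w + 2 ^ d \<le> int n"
      by (metis of_nat_add of_nat_le_iff of_nat_numeral of_nat_power)
    moreover have "(2::int) ^ d \<le> int w"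
      using \<open>2 ^ d \<le> w\<close> by (metis of_nat_le_iff of_nat_numeral of_nat_power)
    ultimately show ?thesis using small by linarith
  qed
  ultimately show False by linarith
qed

text \<open>The signs in \<open>G \<inter> B\<close> already show in the position of the walker with digit set \<open>B\<close> and do not enter
its later displacements. The relevant part of the hidden state is \<open>\<gamma> = G - B\<close>. In a round the displacement takes over signs from
\<open>\<gamma>\<close>, and \<open>\<gamma>\<close> receives in return the fresh signs that the displacement does not use. So the pair is
merely rearranged, and the same rearrangement undoes it.\<close>

definition exchange :: "nat set \<Rightarrow> nat \<times> nat set \<Rightarrow> nat \<times> nat set" where
  "exchange B = (\<lambda>(z, \<gamma>). (jump B z \<gamma>, redraw z \<gamma> - B))"

lemma exchange_reduced:
  "jump B z G = jump B z (G - B)" "redraw z G - B = redraw z (G - B) - B"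
proof -
  have "G \<inter> {1..level z} - B = (G - B) \<inter> {1..level z} - B" by auto
  then show "jump B z G = jump B z (G - B)" by (simp add: jump_def)
qed (auto simp: redraw_def)

lemma exchange_mem:
  assumes "z \<in> {a..<n}" "\<gamma> \<subseteq> {1..d} - B"
  shows "exchange B (z, \<gamma>) \<in> {a..<n} \<times> Pow ({1..d} - B)"
  using jump_block(1)[OF assms(1)] redraw_subset[of \<gamma> z] assms by (auto simp: exchange_def)

lemma exchange_involution:
  assumes z: "z \<in> {a..<n}" and \<gamma>: "\<gamma> \<subseteq> {1..d} - B"
  shows "exchange B (exchange B (z, \<gamma>)) = (z, \<gamma>)"
proof -
  let ?I = "{1..level z}"
  define w where "w = jump B z \<gamma>"
  define \<gamma>' where "\<gamma>' = redraw z \<gamma> - B"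
  note w = jump_block[OF z, of B \<gamma>, folded w_def]
  have "(signs w - (?I - B)) \<union> (\<gamma>' \<inter> ?I - B) = signs z"
    unfolding w(4) \<gamma>'_def redraw_def by auto
  then have "jump B w \<gamma>' = z"
    using start_plus_encode[OF z] by (simp add: jump_def w)
  moreover have "redraw w \<gamma>' - B = \<gamma>"
    unfolding redraw_def w(3,4) \<gamma>'_def using \<gamma> by auto
  ultimately show ?thesis by (simp add: exchange_def w_def \<gamma>'_def)
qed

end

section \<open>The next move is a function of the current positions\<close>

lemma map_pmf_of_set_const:
  assumes "finite A" "A \<noteq> {}" "\<And>z. z \<in> A \<Longrightarrow> f z = y"
  shows "map_pmf f (pmf_of_set A) = return_pmf y"
proof -
  have "map_pmf f (pmf_of_set A) = map_pmf (\<lambda>_. y) (pmf_of_set A)"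
    using assms by (intro map_pmf_cong) auto
  then show ?thesis by simp
qed

lemma map_pmf_of_set_fair:
  assumes A: "finite A" "A \<noteq> {}"
    and f: "\<And>z. z \<in> A \<Longrightarrow> f z \<in> A \<and> f (f z) = z \<and> (P (f z) \<longleftrightarrow> \<not> P z)"
  shows "map_pmf P (pmf_of_set A) = pmf_of_set (UNIV :: bool set)"
proof (rule pmf_eqI)
  fix b
  have bij: "bij_betw f (A \<inter> {z. P z}) (A \<inter> {z. \<not> P z})"
    by (rule bij_betwI[where g = f]) (use f in auto)
  have eq: "card (A \<inter> {z. P z}) = card (A \<inter> {z. \<not> P z})"
    using bij by (rule bij_betw_same_card)
  have "card ((A \<inter> {z. P z}) \<union> (A \<inter> {z. \<not> P z})) = card (A \<inter> {z. P z}) + card (A \<inter> {z. \<not> P z})"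
    by (rule card_Un_disjoint) (use A in auto)
  also have "(A \<inter> {z. P z}) \<union> (A \<inter> {z. \<not> P z}) = A" by auto
  finally have card: "card A = 2 * card (A \<inter> {z. P z})" using eq by simp
  have "card A > 0" using A by (simp add: card_gt_0_iff)
  have "P -` {b} = (if b then {z. P z} else {z. \<not> P z})" by auto
  then have "card (A \<inter> P -` {b}) = card (A \<inter> {z. P z})" using eq by simp
  then have "pmf (map_pmf P (pmf_of_set A)) b = card (A \<inter> {z. P z}) / card A"
    using A by (simp add: pmf_map measure_pmf_of_set)
  also have "\<dots> = 1 / 2" using card \<open>card A > 0\<close> by simp
  finally show "pmf (map_pmf P (pmf_of_set A)) b = pmf (pmf_of_set UNIV) b"
    by (simp add: UNIV_bool)
qed

context tiling
begin

text \<open>The values of \<open>z\<close> that explain the moves already made in the current round, when the round began at origin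
\<open>c\<close> with signs \<open>G\<close>.\<close>

definition compatible :: "int \<Rightarrow> nat set \<Rightarrow> nat \<Rightarrow> (nat \<Rightarrow> nat) \<Rightarrow> nat set" where
  "compatible c G j cur = {z \<in> {a..<n}. \<forall>i<j. moved c G z i = cur i}"

definition move_law :: "int \<Rightarrow> nat set \<Rightarrow> nat \<Rightarrow> (nat \<Rightarrow> nat) \<Rightarrow> nat pmf" where
  "move_law c G j cur = map_pmf (\<lambda>z. moved c G z j) (pmf_of_set (compatible c G j cur))"

lemma finite_compatible [simp]: "finite (compatible c G j cur)"
  by (simp add: compatible_def)

text \<open>Walker \<open>0\<close> shows the origin and walker \<open>2 ^ (l - 1)\<close> the sign at level \<open>l\<close>, so the positions of
all walkers determine the state.\<close>

lemma state_unique: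
  assumes k: "\<And>l. l \<in> {1..d} \<Longrightarrow> 2 ^ (l - 1) < k" "0 < k"
    and G: "G \<subseteq> {1..d}" "G' \<subseteq> {1..d}"
    and eq: "\<And>i. i < k \<Longrightarrow> pos c G i = pos c' G' i"
  shows "G = G'" "int n dvd c - c'"
proof -
  show c: "int n dvd c - c'"
    using eq[OF k(2)] by (simp add: pos_eq_iff)
  have "l \<in> G \<longleftrightarrow> l \<in> G'" if l: "l \<in> {1..d}" for l
  proof (rule ccontr)
    assume neq: "\<not> (l \<in> G \<longleftrightarrow> l \<in> G')"
    let ?i = "2 ^ (l - 1)"
    have "int n dvd (c + offset G ?i) - (c' + offset G' ?i)"
      using eq[OF k(1)[OF l]] by (simp add: pos_eq_iff)
    then have "int n dvd ((c + offset G ?i) - (c' + offset G' ?i)) - (c - c')"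
      using c by (rule dvd_diff)
    then have dvd: "int n dvd offset G ?i - offset G' ?i" by (simp add: algebra_simps)
    define h :: int where "h = 2 ^ (l - 1)"
    have l1: "l \<ge> 1" using l by simp
    have offsets: "offset G ?i = (if l \<in> G then h else - h)" "offset G' ?i = (if l \<in> G' then h else - h)"
      unfolding h_def by (rule offset_power[OF l1])+
    have "h > 0" by (simp add: h_def)
    have "2 * h = 2 ^ l" using l by (cases l) (auto simp: h_def)
    moreover have "(2::int) ^ l \<le> 2 ^ d" using l by (intro power_increasing) auto
    ultimately have "2 * h < int n" using n_int by linarith
    then have "\<bar>offset G ?i - offset G' ?i\<bar> < int n \<and> offset G ?i - offset G' ?i \<noteq> 0"
      unfolding offsets using neq \<open>h > 0\<close> by (cases "l \<in> G"; cases "l \<in> G'"; simp)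
    then show False using dvd no_dvd_small by blast
  qed
  then show "G = G'" using G by blast
qed

lemma moved_cong: "int n dvd c - c' \<Longrightarrow> moved c G z i = moved c' G z i"
  by (simp add: moved_def pos_eq_iff algebra_simps)

text \<open>A walker with several digits moves after the walkers that appear on the right, so it can copy their new signs.\<close>

lemma pos_affine:
  "int (pos c G j) = (int (pos c G 0) + (\<Sum>l\<in>bits j. int (pos c G (2 ^ (l - 1))) - int (pos c G 0))) mod int n"
proof -
  have dvd: "int n dvd x - x mod int n" for x
    by (rule dvd_minus_mod)
  have "(c + (\<Sum>l\<in>bits j. (c + offset G (2 ^ (l - 1))) - c)) -
      (c mod int n + (\<Sum>l\<in>bits j. (c + offset G (2 ^ (l - 1))) mod int n - c mod int n)) =
    (c - c mod int n) + (\<Sum>l\<in>bits j. ((c + offset G (2 ^ (l - 1))) - (c + offset G (2 ^ (l - 1))) mod int n) -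
      (c - c mod int n))"
    by (simp add: sum_subtractf sum.distrib)
  also have "int n dvd \<dots>"
    by (intro dvd_add dvd_sum dvd_diff dvd)
  finally show ?thesis
    using offset_sum[of G j] by (simp add: pos_int mod_eq_dvd_iff)
qed

lemma moved_power:
  assumes "l \<ge> 1"
  shows "moved c G z (2 ^ (l - 1)) =
    nat ((int (moved c G z 0) + (if l \<in> redraw z G then 2 ^ (l - 1) else - (2 ^ (l - 1)))) mod int n)"
proof -
  have "int (moved c G z (2 ^ (l - 1))) = (int (moved c G z 0) + offset (redraw z G) (2 ^ (l - 1))) mod int n"
    by (simp add: moved_def pos_int mod_add_left_eq)
  then show ?thesis by (simp only: offset_power[OF assms] nat_int[symmetric])
qed

text \<open>Walker \<open>2 ^ (l - 1)\<close>, about to move, sees the new position of walker \<open>0\<close> and its own old one. Their difference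
is \<open>w - g\<^sub>l\<close>, where \<open>w\<close> is the displacement of walker \<open>0\<close>. If another state and displacement \<open>w'\<close> with the opposite sign
explain the same difference, then \<open>w\<close> and \<open>w'\<close> differ by \<open>2 ^ l\<close>. If level \<open>l\<close> is kept at \<open>w\<close>, then \<open>w'\<close> cannot
redraw it, as changing that sign would lead from \<open>w'\<close> to \<open>w\<close> within one block; nor can it keep it, by
isolation. Hence the sign is the same and \<open>w = w'\<close>.\<close>

lemma frozen_level_visible:
  assumes G: "G \<subseteq> {1..d}" "G' \<subseteq> {1..d}" and z: "z \<in> {a..<n}" "z' \<in> {a..<n}"
    and l: "l \<in> {1..d}" "level z < l"
    and moved: "moved c G z 0 = moved c' G' z' 0"
    and pos: "pos c G (2 ^ (l - 1)) = pos c' G' (2 ^ (l - 1))"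
  shows "level z' < l" "l \<in> G \<longleftrightarrow> l \<in> G'"
proof -
  let ?j = "2 ^ (l - 1)"
  define w w' where "w = jump {} z G" and "w' = jump {} z' G'"
  note w = jump_block[OF z(1), of "{}" G, folded w_def]
  note w' = jump_block[OF z(2), of "{}" G', folded w'_def]
  have "int n dvd (c + int w) - (c' + int w')"
    using moved by (simp add: moved_def pos_eq_iff w_def w'_def)
  moreover have "int n dvd (c + offset G ?j) - (c' + offset G' ?j)"
    using pos by (simp add: pos_eq_iff)
  ultimately have "int n dvd ((c + int w) - (c' + int w')) - ((c + offset G ?j) - (c' + offset G' ?j))"
    by (rule dvd_diff)
  then have dvd: "int n dvd (int w - int w') - (offset G ?j - offset G' ?j)"
    by (simp add: algebra_simps)
  have wn: "w < n" "w' < n" using w(1) w'(1) by auto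
  have lw: "level w < l" using w(3) l by simp
  have wd: "2 ^ d \<le> w" "w \<le> n - 2 ^ d" using partial[OF w(1)] lw l by auto
  have ld: "(2::nat) ^ l \<le> 2 ^ d" using l by (intro power_increasing) auto
  have l1: "l \<ge> 1" using l by simp
  define h :: int where "h = 2 ^ (l - 1)"
  have offsets: "offset G ?j = (if l \<in> G then h else - h)" "offset G' ?j = (if l \<in> G' then h else - h)"
    unfolding h_def by (rule offset_power[OF l1])+
  have l2: "(2::int) ^ l = 2 * h" using l by (cases l) (auto simp: h_def)
  have Sw': "l \<in> signs w' \<longleftrightarrow> l \<in> G'" if "l \<le> level z'"
    using w'(4) that l by auto
  have case_plus: False if "l \<in> G" "l \<notin> G'"
  proof -
    have "(int w - int w') - (offset G ?j - offset G' ?j) = int w - int (w' + 2 ^ l)"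
      unfolding offsets using that l2 by simp
    then have "int n dvd int w - int (w' + 2 ^ l)" using dvd by (simp only:)
    moreover have "int w - int (w' + 2 ^ l) \<noteq> 0 \<longrightarrow> \<bar>int w - int (w' + 2 ^ l)\<bar> < int n"
      using wn wd ld n by linarith
    ultimately have eq: "w = w' + 2 ^ l"
      using no_dvd_small[of "int w - int (w' + 2 ^ l)"] by linarith
    show False
    proof (cases "level z' < l")
      case True
      then show False using isolated[OF w(1) w'(1) lw] w'(3) l eq by auto
    next
      case False
      then have nl: "l \<notin> signs w'" using Sw' that by simp
      have "level (start w' + set_encode (insert l (signs w'))) = level w'"
        by (rule same_block(3)[OF w'(1)]) (use signs_subset[OF w'(1)] False w'(3) l1 in auto)
      moreover have "start w' + set_encode (insert l (signs w')) = w"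
        using start_plus_encode[OF w'(1)] nl eq by simp
      ultimately show False using lw False w'(3) by simp
    qed
  qed
  have case_minus: False if "l \<notin> G" "l \<in> G'"
  proof -
    \<comment> \<open>with \<open>w \<le> n - 2 ^ d\<close> this excludes \<open>w + 2 ^ l = w' + n\<close>\<close>
    have w'0: "0 < w'"
    proof (cases "level z' < l")
      case True
      then have "2 ^ d \<le> w'" using partial[OF w'(1)] w'(3) l by auto
      moreover have "(0::nat) < 2 ^ d" by simp
      ultimately show ?thesis by linarith
    next
      case False
      then have "l \<in> signs w'" using Sw' that by simp
      then have "2 ^ l \<le> set_encode (signs w')" by (intro power_le_set_encode) auto
      then show ?thesis using start_plus_encode[OF w'(1)] by (metis add_is_0 gr0I le_zero_eq power_not_zero zero_neq_numeral)
    qed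
    have "(int w - int w') - (offset G ?j - offset G' ?j) = int (w + 2 ^ l) - int w'"
      unfolding offsets using that l2 by simp
    then have "int n dvd int (w + 2 ^ l) - int w'" using dvd by (simp only:)
    moreover have "int (w + 2 ^ l) - int w' \<noteq> 0 \<longrightarrow> \<bar>int (w + 2 ^ l) - int w'\<bar> < int n"
      using wn wd ld n w'0 by linarith
    ultimately have eq: "w' = w + 2 ^ l"
      using no_dvd_small[of "int (w + 2 ^ l) - int w'"] by linarith
    show False
    proof (cases "level z' < l")
      case True
      then show False using isolated[OF w'(1) w(1) _ lw] w'(3) l eq by auto
    next
      case False
      then have nl: "l \<in> signs w'" using Sw' that by simp
      have "level (start w' + set_encode (signs w' - {l})) = level w'"
        by (rule same_block(3)[OF w'(1)]) (use signs_subset[OF w'(1)] False w'(3) l1 in auto)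
      moreover have "set_encode (signs w') = 2 ^ l + set_encode (signs w' - {l})"
        using set_encode_insert[of "signs w' - {l}" l] nl by (simp add: insert_absorb)
      then have "start w' + set_encode (signs w' - {l}) = w"
        using start_plus_encode[OF w'(1)] eq by simp
      ultimately show False using lw False w'(3) by simp
    qed
  qed
  show same: "l \<in> G \<longleftrightarrow> l \<in> G'" using case_plus case_minus by blast
  have "(int w - int w') - (offset G ?j - offset G' ?j) = int w - int w'"
    unfolding offsets using same by simp
  then have "int n dvd int w - int w'" using dvd by (simp only:)
  then have "w = w'" using no_dvd_small[of "int w - int w'"] wn by linarith
  then show "level z' < l" using lw w'(3) by simp
qed

definition flip :: "nat \<Rightarrow> nat \<Rightarrow> nat" where
  "flip l z = start z + set_encode (if l \<in> signs z then signs z - {l} else insert l (signs z))"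

lemma flip_level:
  assumes z: "z \<in> {a..<n}" and l: "l \<in> {1..level z}"
  shows "flip l z \<in> {a..<n}" "flip l (flip l z) = z" "l \<in> redraw (flip l z) G \<longleftrightarrow> l \<notin> redraw z G"
    "i < 2 ^ (l - 1) \<Longrightarrow> moved c G (flip l z) i = moved c G z i"
proof -
  let ?W = "if l \<in> signs z then signs z - {l} else insert l (signs z)"
  have W: "?W \<subseteq> {..level z}" "?W - {1..level z} = signs z - {1..level z}"
    using signs_subset[OF z] l by auto
  note f = same_block[OF z W, folded flip_def]
  show "flip l z \<in> {a..<n}" by (rule f(1))
  have "(if l \<in> ?W then ?W - {l} else insert l ?W) = signs z" by auto
  then show "flip l (flip l z) = z"
    using start_plus_encode[OF z] by (simp only: flip_def[of l "flip l z"] f)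
  show "l \<in> redraw (flip l z) G \<longleftrightarrow> l \<notin> redraw z G"
    using l by (auto simp: redraw_def f)
  show "moved c G (flip l z) i = moved c G z i" if i: "i < 2 ^ (l - 1)"
  proof -
    have "l \<notin> bits i" using bits_subset[OF i] l by fastforce
    then have "redraw (flip l z) G \<inter> bits i = redraw z G \<inter> bits i"
      unfolding redraw_def f by auto
    moreover have "jump {} (flip l z) G = jump {} z G"
      using W(2) by (simp add: jump_def f)
    ultimately show ?thesis by (simp add: moved_def pos_def offset_def)
  qed
qed

text \<open>Walker \<open>0\<close> sees the old positions of all walkers, hence the state. A walker with several digits copies the new signs from walkers
that have already moved. Walker \<open>2 ^ (l - 1)\<close> is the first to use the new sign at level \<open>l\<close>. Either the level
is kept in every compatible explanation, always with the same sign, or it is redrawn in every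
explanation; then switching this digit of \<open>z\<close> shows that the new sign is a fair coin.\<close>

lemma move_law_unique:
  assumes k: "\<And>l. l \<in> {1..d} \<Longrightarrow> 2 ^ (l - 1) < k" "k \<le> 2 ^ d" and j: "j < k"
    and G: "G \<subseteq> {1..d}" "G' \<subseteq> {1..d}"
    and pos: "\<And>i. j \<le> i \<Longrightarrow> i < k \<Longrightarrow> pos c G i = cur i" "\<And>i. j \<le> i \<Longrightarrow> i < k \<Longrightarrow> pos c' G' i = cur i"
    and ne: "compatible c G j cur \<noteq> {}" "compatible c' G' j cur \<noteq> {}"
  shows "move_law c G j cur = move_law c' G' j cur"
proof -
  consider "j = 0" | l where "l \<in> {1..d}" "j = 2 ^ (l - 1)"
    | "j > 0" "\<And>l. l \<in> {1..d} \<Longrightarrow> j \<noteq> 2 ^ (l - 1)" by blast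
  then show ?thesis
  proof cases
    case 1
    have "G = G'" "int n dvd c - c'"
      using state_unique[of k G G' c c'] k(1) j G pos 1 by auto
    then have "moved c G z i = moved c' G' z i" for z i
      using moved_cong by simp
    then show ?thesis by (simp add: move_law_def compatible_def)
  next
    case (2 l)
    then have l1: "l \<ge> 1" by simp
    have j0: "0 < j" using 2 by simp
    define sgn :: "bool \<Rightarrow> nat"
      where "sgn b = nat ((int (cur 0) + (if b then 2 ^ (l - 1) else - (2 ^ (l - 1)))) mod int n)" for b
    have nxt_j: "moved x H z j = sgn (l \<in> redraw z H)" if "z \<in> compatible x H j cur" for x H z
      using that j0 moved_power[OF l1, of x H z] by (simp add: sgn_def compatible_def 2)
    have frozen: "move_law x' H' j cur = return_pmf (sgn (l \<in> H))"
      if "z \<in> compatible x H j cur" "level z < l" "H \<subseteq> {1..d}" "H' \<subseteq> {1..d}"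
        "\<And>i. j \<le> i \<Longrightarrow> i < k \<Longrightarrow> pos x H i = cur i" "\<And>i. j \<le> i \<Longrightarrow> i < k \<Longrightarrow> pos x' H' i = cur i"
        "compatible x' H' j cur \<noteq> {}" for x H x' H' z
      unfolding move_law_def
    proof (rule map_pmf_of_set_const)
      fix z' assume z': "z' \<in> compatible x' H' j cur"
      have *: "level z' < l" "l \<in> H \<longleftrightarrow> l \<in> H'"
        using frozen_level_visible[of H H' z z' l x x'] that z' 2 j0 j by (auto simp: compatible_def)
      then have "l \<in> redraw z' H' \<longleftrightarrow> l \<in> H" by (auto simp: redraw_def)
      then show "moved x' H' z' j = sgn (l \<in> H)" using nxt_j[OF z'] by simp
    qed (use that in auto)
    have fresh: "move_law x H j cur = map_pmf sgn (pmf_of_set UNIV)"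
      if "\<And>z. z \<in> compatible x H j cur \<Longrightarrow> \<not> level z < l" "compatible x H j cur \<noteq> {}" for x H
    proof -
      have "map_pmf (\<lambda>z. l \<in> redraw z H) (pmf_of_set (compatible x H j cur)) = pmf_of_set UNIV"
      proof (rule map_pmf_of_set_fair[where f = "flip l"])
        fix z assume z: "z \<in> compatible x H j cur"
        then have "z \<in> {a..<n}" "l \<in> {1..level z}" using that(1)[OF z] l1 by (auto simp: compatible_def)
        note fl = flip_level[OF this]
        show "flip l z \<in> compatible x H j cur \<and> flip l (flip l z) = z \<and> (l \<in> redraw (flip l z) H) = (l \<notin> redraw z H)"
          using fl z 2 by (auto simp: compatible_def)
      qed (use that in auto)
      then have "map_pmf sgn (pmf_of_set UNIV) =
          map_pmf sgn (map_pmf (\<lambda>z. l \<in> redraw z H) (pmf_of_set (compatible x H j cur)))" by simp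
      also have "\<dots> = move_law x H j cur"
        unfolding move_law_def map_pmf_comp by (rule map_pmf_cong) (use nxt_j that in auto)
      finally show ?thesis by simp
    qed
    show ?thesis
    proof (cases "\<exists>z. z \<in> compatible c G j cur \<union> compatible c' G' j cur \<and> level z < l")
      case True
      then obtain z where "z \<in> compatible c G j cur \<and> level z < l \<or> z \<in> compatible c' G' j cur \<and> level z < l" by blast
      then show ?thesis
      proof
        assume z: "z \<in> compatible c G j cur \<and> level z < l"
        show ?thesis
          using frozen[of z c G G c] frozen[of z c G G' c'] z G pos ne by simp
      next
        assume z: "z \<in> compatible c' G' j cur \<and> level z < l"
        show ?thesis
          using frozen[of z c' G' G c] frozen[of z c' G' G' c'] z G pos ne by simp
      qed
    next
      case False
      have "move_law c G j cur = map_pmf sgn (pmf_of_set UNIV)"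
        by (rule fresh) (use False ne in blast)+
      moreover have "move_law c' G' j cur = map_pmf sgn (pmf_of_set UNIV)"
        by (rule fresh) (use False ne in blast)+
      ultimately show ?thesis by simp
    qed
  next
    case 3
    define y where "y = nat ((int (cur 0) + (\<Sum>l\<in>bits j. int (cur (2 ^ (l - 1))) - int (cur 0))) mod int n)"
    have "move_law x H j cur = return_pmf y" if "compatible x H j cur \<noteq> {}" for x H
      unfolding move_law_def
    proof (rule map_pmf_of_set_const)
      fix z assume z: "z \<in> compatible x H j cur"
      have "2 ^ (l - 1) < j" if l: "l \<in> bits j" for l
      proof -
        have ld: "l \<in> {1..d}" using bits_subset[of j d] j k(2) l by auto
        have "2 ^ l \<le> 2 * j" using power_le_set_encode[of "bits j" l] l by (simp add: set_encode_bits)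
        moreover have "(2::nat) ^ l = 2 * 2 ^ (l - 1)" using ld by (cases l) auto
        ultimately show ?thesis using 3(2)[OF ld] by linarith
      qed
      then have "moved x H z (2 ^ (l - 1)) = cur (2 ^ (l - 1))" if "l \<in> bits j" for l
        using z that by (simp add: compatible_def)
      moreover have "moved x H z 0 = cur 0" using z 3(1) by (simp add: compatible_def)
      ultimately have "int (moved x H z j) = (int (cur 0) + (\<Sum>l\<in>bits j. int (cur (2 ^ (l - 1))) - int (cur 0))) mod int n"
        using pos_affine[of "x + int (jump {} z H)" "redraw z H" j] by (simp add: moved_def)
      then show "moved x H z j = y" by (simp add: y_def nat_int[symmetric] del: nat_int)
    qed (use that in auto)
    then show ?thesis using ne by simp
  qed
qed

end

section \<open>Independent inputs\<close>

text \<open>A product of products, so that the sample points have the type required of the coupling; the input of round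
\<open>t\<close> is read off at \<open>\<omega> t 0\<close>.\<close>

definition coord_space :: "(nat \<Rightarrow> nat pmf) \<Rightarrow> (nat \<Rightarrow> nat \<Rightarrow> nat) measure" where
  "coord_space p = (\<Pi>\<^sub>M t\<in>UNIV. \<Pi>\<^sub>M _\<in>UNIV. measure_pmf (p t))"

definition row :: "(nat \<Rightarrow> nat \<Rightarrow> nat) \<Rightarrow> nat \<Rightarrow> nat" where
  "row \<omega> t = \<omega> t 0"

lemma prob_space_coord_space: "prob_space (coord_space p)"
  unfolding coord_space_def
  by (intro prob_space_PiM measure_pmf.prob_space_axioms)

lemma space_coord_space [simp]: "space (coord_space p) = UNIV"
  by (simp add: coord_space_def space_PiM)

lemma distr_row: "distr (coord_space p) (count_space UNIV) (\<lambda>\<omega>. row \<omega> t) = measure_pmf (p t)"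
proof -
  let ?K = "\<lambda>t. \<Pi>\<^sub>M _\<in>(UNIV::nat set). measure_pmf (p t)"
  have K: "prob_space (?K t)" for t
    by (intro prob_space_PiM measure_pmf.prob_space_axioms)
  have 1: "distr (coord_space p) (?K t) (\<lambda>\<omega>. \<omega> t) = ?K t"
    unfolding coord_space_def by (rule distr_PiM_component) (use K in auto)
  have 2: "distr (?K t) (measure_pmf (p t)) (\<lambda>x. x 0) = measure_pmf (p t)"
    by (rule distr_PiM_component) (auto intro: measure_pmf.prob_space_axioms)
  have "distr (coord_space p) (measure_pmf (p t)) (\<lambda>\<omega>. \<omega> t 0) =
      distr (distr (coord_space p) (?K t) (\<lambda>\<omega>. \<omega> t)) (measure_pmf (p t)) (\<lambda>x. x 0)"
    unfolding coord_space_def by (subst distr_distr) (auto simp: comp_def)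
  also have "\<dots> = measure_pmf (p t)" by (simp only: 1 2)
  finally have "distr (coord_space p) (measure_pmf (p t)) (\<lambda>\<omega>. \<omega> t 0) = measure_pmf (p t)" .
  moreover have "distr (coord_space p) (count_space UNIV) (\<lambda>\<omega>. row \<omega> t) =
      distr (coord_space p) (measure_pmf (p t)) (\<lambda>\<omega>. \<omega> t 0)"
    unfolding row_def by (rule distr_cong) auto
  ultimately show ?thesis by simp
qed

lemma measurable_row [measurable]: "(\<lambda>\<omega>. row \<omega> t) \<in> measurable (coord_space p) (count_space UNIV)"
proof -
  let ?K = "\<lambda>t. \<Pi>\<^sub>M _\<in>(UNIV::nat set). measure_pmf (p t)"
  have "(\<lambda>\<omega>. \<omega> t) \<in> measurable (coord_space p) (?K t)"
    unfolding coord_space_def by (rule measurable_component_singleton) simp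
  moreover have "(\<lambda>x. x 0) \<in> measurable (?K t) (measure_pmf (p t))"
    by (rule measurable_component_singleton) simp
  ultimately have "(\<lambda>\<omega>. \<omega> t 0) \<in> measurable (coord_space p) (measure_pmf (p t))"
    by (rule measurable_compose)
  then show ?thesis by (simp add: row_def measurable_pmf_measure2)
qed

lemma indep_rows: "prob_space.indep_vars (coord_space p) (\<lambda>_. count_space UNIV) (\<lambda>t \<omega>. row \<omega> t) UNIV"
proof -
  interpret prob_space "coord_space p" by (rule prob_space_coord_space)
  let ?K = "\<lambda>t. \<Pi>\<^sub>M _\<in>(UNIV::nat set). measure_pmf (p t)"
  have K: "prob_space (?K t)" for t
    by (intro prob_space_PiM measure_pmf.prob_space_axioms)
  have comp: "(\<lambda>\<omega>. \<omega> t) \<in> measurable (coord_space p) (?K t)" for t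
    unfolding coord_space_def by (rule measurable_component_singleton) simp
  have "distr (coord_space p) (PiM UNIV ?K) (\<lambda>x. \<lambda>i\<in>UNIV. x i) = distr (PiM UNIV ?K) (PiM UNIV ?K) (\<lambda>x. x)"
    by (simp add: coord_space_def restrict_UNIV)
  also have "\<dots> = PiM UNIV ?K" by simp
  also have "\<dots> = PiM UNIV (\<lambda>i. distr (coord_space p) (?K i) (\<lambda>\<omega>. \<omega> i))"
    unfolding coord_space_def by (intro PiM_cong refl distr_PiM_component[symmetric] K UNIV_I)
  finally have "indep_vars ?K (\<lambda>t \<omega>. \<omega> t) UNIV"
    by (subst indep_vars_iff_distr_eq_PiM) (use comp in auto)
  moreover have "(\<lambda>x. x 0) \<in> measurable (?K t) (count_space UNIV)" for t
  proof -
    have "(\<lambda>x. x 0) \<in> measurable (?K t) (measure_pmf (p t))"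
      by (rule measurable_component_singleton) simp
    then show ?thesis by (simp add: measurable_pmf_measure2)
  qed
  ultimately have "indep_vars (\<lambda>_. count_space UNIV) (\<lambda>t \<omega>. (\<lambda>x. x 0) (\<omega> t)) UNIV"
    by (rule indep_vars_compose2)
  then show ?thesis by (simp add: row_def)
qed

text \<open>Only finitely many inputs matter up to a fixed time, which makes all events of interest measurable.\<close>

definition determined_by :: "nat \<Rightarrow> ((nat \<Rightarrow> nat) \<Rightarrow> 'b) \<Rightarrow> bool" where
  "determined_by t Q \<longleftrightarrow> (\<forall>u v. (\<forall>s\<le>t. u s = v s) \<longrightarrow> Q u = Q v)"

lemma measurable_determined:
  assumes "determined_by t Q"
  shows "(\<lambda>\<omega>. Q (row \<omega>)) \<in> measurable (coord_space p) (count_space UNIV)"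
proof -
  let ?P = "PiM {..t} (\<lambda>_. count_space (UNIV :: nat set))"
  have P: "?P = count_space (PiE {..t} (\<lambda>_. UNIV))"
    by (rule count_space_PiM_finite) auto
  have "(\<lambda>\<omega>. restrict (row \<omega>) {..t}) \<in> measurable (coord_space p) ?P"
    by (rule measurable_restrict) (rule measurable_row)
  moreover have "Q \<in> measurable ?P (count_space UNIV)" unfolding P by simp
  ultimately have "(\<lambda>\<omega>. Q (restrict (row \<omega>) {..t})) \<in> measurable (coord_space p) (count_space UNIV)"
    by (rule measurable_compose)
  moreover have "Q (restrict (row \<omega>) {..t}) = Q (row \<omega>)" for \<omega>
    using assms by (auto simp: determined_by_def)
  ultimately show ?thesis by simp
qed

lemma sets_determined:
  assumes "determined_by t Q"
  shows "{\<omega>. Q (row \<omega>)} \<in> sets (coord_space p)"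
proof -
  have "(\<lambda>\<omega>. Q (row \<omega>)) -` {True} \<inter> space (coord_space p) \<in> sets (coord_space p)"
    by (rule measurable_sets[OF measurable_determined[OF assms]]) simp
  then show ?thesis by (simp add: vimage_def)
qed

lemma measure_row: "measure (coord_space p) {\<omega>. row \<omega> t \<in> B} = measure (p t) B"
proof -
  have "measure (p t) B = measure (distr (coord_space p) (count_space UNIV) (\<lambda>\<omega>. row \<omega> t)) B"
    by (simp add: distr_row)
  also have "\<dots> = measure (coord_space p) {\<omega>. row \<omega> t \<in> B}"
    by (subst measure_distr) (auto simp: vimage_def)
  finally show ?thesis by simp
qed

lemma measure_next_row:
  assumes Q: "determined_by t Q"
  shows "measure (coord_space p) {\<omega>. Q (row \<omega>) \<and> row \<omega> (Suc t) \<in> B} =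
    measure (coord_space p) {\<omega>. Q (row \<omega>)} * measure (p (Suc t)) B"
proof -
  interpret prob_space "coord_space p" by (rule prob_space_coord_space)
  let ?C = "\<lambda>_. count_space (UNIV :: nat set)"
  have ind: "indep_var (PiM {..t} ?C) (\<lambda>\<omega>. restrict (\<lambda>i. row \<omega> i) {..t})
      (PiM {Suc t} ?C) (\<lambda>\<omega>. restrict (\<lambda>i. row \<omega> i) {Suc t})"
    by (rule indep_var_restrict[OF indep_rows]) auto
  have P: "PiM J ?C = count_space (PiE J (\<lambda>_. UNIV))" if "finite J" for J :: "nat set"
    by (rule count_space_PiM_finite) (use that in auto)
  let ?A = "{f \<in> PiE {..t} (\<lambda>_. UNIV). Q f}" and ?B = "{f \<in> PiE {Suc t} (\<lambda>_. UNIV). f (Suc t) \<in> B}"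
  have Qr: "Q (restrict (row \<omega>) {..t}) = Q (row \<omega>)" for \<omega>
    using Q by (auto simp: determined_by_def)
  have "prob ((\<lambda>x. (restrict (\<lambda>i. row x i) {..t}, restrict (\<lambda>i. row x i) {Suc t})) -` (?A \<times> ?B) \<inter> space (coord_space p)) =
    prob ((\<lambda>\<omega>. restrict (\<lambda>i. row \<omega> i) {..t}) -` ?A \<inter> space (coord_space p)) *
    prob ((\<lambda>\<omega>. restrict (\<lambda>i. row \<omega> i) {Suc t}) -` ?B \<inter> space (coord_space p))"
    by (rule indep_varD[OF ind]) (simp_all add: P)
  moreover have "(\<lambda>x. (restrict (\<lambda>i. row x i) {..t}, restrict (\<lambda>i. row x i) {Suc t})) -` (?A \<times> ?B) \<inter> space (coord_space p)
      = {\<omega>. Q (row \<omega>) \<and> row \<omega> (Suc t) \<in> B}"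
    by (auto simp: Qr)
  moreover have "(\<lambda>\<omega>. restrict (\<lambda>i. row \<omega> i) {..t}) -` ?A \<inter> space (coord_space p) = {\<omega>. Q (row \<omega>)}"
    by (auto simp: Qr)
  moreover have "(\<lambda>\<omega>. restrict (\<lambda>i. row \<omega> i) {Suc t}) -` ?B \<inter> space (coord_space p) = {\<omega>. row \<omega> (Suc t) \<in> B}"
    by auto
  ultimately show ?thesis by (simp add: measure_row)
qed

lemma AE_row: "AE \<omega> in coord_space p. \<forall>t. row \<omega> t \<in> set_pmf (p t)"
proof -
  have "AE \<omega> in coord_space p. row \<omega> t \<in> set_pmf (p t)" for t
  proof -
    have "AE z in measure_pmf (p t). z \<in> set_pmf (p t)" by (simp add: AE_measure_pmf)
    then have "AE z in distr (coord_space p) (count_space UNIV) (\<lambda>\<omega>. row \<omega> t). z \<in> set_pmf (p t)"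
      by (simp only: distr_row)
    then show ?thesis by (subst (asm) AE_distr_iff) auto
  qed
  then show ?thesis by (simp add: AE_all_countable)
qed

section \<open>Each walker performs a random walk\<close>

context tiling
begin

text \<open>Origin and signs, driven by an input sequence: \<open>\<zeta> 0\<close> encodes the initial signs and \<open>\<zeta> (Suc t)\<close> drives the
round from time \<open>t\<close> to \<open>Suc t\<close>. The initial signs must be random, because a walker's first displacement depends on those that
its starting position does not show.\<close>

primrec state :: "(nat \<Rightarrow> nat) \<Rightarrow> nat \<Rightarrow> int \<times> nat set" where
  "state \<zeta> 0 = (0, set_decode (\<zeta> 0))"
| "state \<zeta> (Suc t) = (fst (state \<zeta> t) + int (jump {} (\<zeta> (Suc t)) (snd (state \<zeta> t))),
     redraw (\<zeta> (Suc t)) (snd (state \<zeta> t)))"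

definition walk :: "nat \<Rightarrow> nat \<Rightarrow> (nat \<Rightarrow> nat) \<Rightarrow> nat" where
  "walk i t \<zeta> = pos (fst (state \<zeta> t)) (snd (state \<zeta> t)) i"

definition input :: "nat \<Rightarrow> nat pmf" where
  "input t = pmf_of_set (if t = 0 then set_encode ` Pow {1..d} else {a..<n})"

abbreviation "\<Omega> \<equiv> coord_space input"

definition legal :: "(nat \<Rightarrow> nat) \<Rightarrow> bool" where
  "legal \<zeta> \<longleftrightarrow> \<zeta> 0 \<in> set_encode ` Pow {1..d} \<and> (\<forall>t. \<zeta> (Suc t) \<in> {a..<n})"

lemma displacements: "{a..<n} \<noteq> {}" "card {a..<n} = n - a" "0 < n - a"
proof -
  have "(1::nat) \<le> 2 ^ d" by simp
  then have "1 < n" using n by linarith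
  then show "{a..<n} \<noteq> {}" "card {a..<n} = n - a" "0 < n - a" using a by auto
qed

lemma AE_legal: "AE \<omega> in \<Omega>. legal (row \<omega>)"
  using AE_row[of input]
proof eventually_elim
  case (elim \<omega>)
  have "set_pmf (input 0) = set_encode ` Pow {1..d}"
    unfolding input_def by (subst set_pmf_of_set) auto
  moreover have "set_pmf (input (Suc t)) = {a..<n}" for t
    unfolding input_def using displacements by (simp add: set_pmf_of_set)
  ultimately show ?case using elim unfolding legal_def by blast
qed

lemma legal_state: "legal \<zeta> \<Longrightarrow> snd (state \<zeta> t) \<subseteq> {1..d}"
proof (induction t)
  case 0
  then obtain A where "A \<subseteq> {1..d}" "\<zeta> 0 = set_encode A" by (auto simp: legal_def)
  moreover then have "finite A" using finite_subset by blast
  ultimately show ?case by simp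
next
  case (Suc t)
  then show ?case using redraw_subset by (simp add: legal_def)
qed

lemma state_cong: "(\<And>s. s \<le> t \<Longrightarrow> \<zeta> s = \<eta> s) \<Longrightarrow> state \<zeta> t = state \<eta> t"
  by (induction t) auto

lemma walk_Suc: "walk i (Suc t) \<zeta> = moved (fst (state \<zeta> t)) (snd (state \<zeta> t)) (\<zeta> (Suc t)) i"
  by (simp add: walk_def moved_def)

lemma walk_less: "walk i t \<zeta> < n"
  by (simp add: walk_def pos_less)

lemma walk_step:
  assumes "legal \<zeta>"
  shows "walk i (Suc t) \<zeta> = (walk i t \<zeta> + jump (bits i) (\<zeta> (Suc t)) (snd (state \<zeta> t) - bits i)) mod n"
proof -
  let ?c = "fst (state \<zeta> t)" and ?G = "snd (state \<zeta> t)" and ?z = "\<zeta> (Suc t)"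
  have fin: "finite ?G" using legal_state[OF assms] finite_subset by blast
  have "int (walk i (Suc t) \<zeta>) = (?c + int (jump {} ?z ?G) + offset (redraw ?z ?G) i) mod int n"
    by (simp add: walk_def pos_int)
  also have "\<dots> = (?c + offset ?G i + int (jump (bits i) ?z ?G)) mod int n"
    using displacement[OF fin, of ?z i] by (simp add: algebra_simps)
  also have "\<dots> = (int (walk i t \<zeta>) + int (jump (bits i) ?z ?G)) mod int n"
    by (simp add: walk_def pos_int mod_add_left_eq)
  also have "\<dots> = int ((walk i t \<zeta> + jump (bits i) ?z (?G - bits i)) mod n)"
    by (simp add: exchange_reduced(1)[of "bits i" ?z ?G] zmod_int)
  finally show ?thesis by simp
qed

lemma measure_input_Suc: "measure (measure_pmf (input (Suc t))) B = card ({a..<n} \<inter> B) / (n - a)"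
  unfolding input_def using displacements by (simp add: measure_pmf_of_set)

lemma measure_legal_eq:
  assumes "\<And>\<zeta>. legal \<zeta> \<Longrightarrow> P \<zeta> \<longleftrightarrow> Q \<zeta>" and "determined_by t P" "determined_by s Q"
  shows "measure \<Omega> {\<omega>. P (row \<omega>)} = measure \<Omega> {\<omega>. Q (row \<omega>)}"
proof -
  interpret prob_space \<Omega> by (rule prob_space_coord_space)
  have "AE \<omega> in \<Omega>. \<omega> \<in> {\<omega>. P (row \<omega>)} \<longleftrightarrow> \<omega> \<in> {\<omega>. Q (row \<omega>)}"
    using AE_legal by eventually_elim (use assms(1) in auto)
  then show ?thesis
    by (rule finite_measure_eq_AE) (use sets_determined assms in auto)
qed

text \<open>The history of walker \<open>i\<close> alone does not carry an induction on time, as its next displacement also depends on the signs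
\<open>\<gamma>\<close> that it has not met.\<close>

definition own_past :: "nat \<Rightarrow> nat \<Rightarrow> (nat \<Rightarrow> nat) \<Rightarrow> nat set \<Rightarrow> (nat \<Rightarrow> nat) \<Rightarrow> bool" where
  "own_past i t h \<gamma> \<zeta> \<longleftrightarrow> (\<forall>s\<le>t. walk i s \<zeta> = h s) \<and> snd (state \<zeta> t) - bits i = \<gamma>"

lemma determined_by_stateI:
  assumes "\<And>u v. (\<And>s. s \<le> t \<Longrightarrow> state u s = state v s) \<Longrightarrow> Q u = Q v"
  shows "determined_by t Q"
  unfolding determined_by_def
proof (intro allI impI)
  fix u v :: "nat \<Rightarrow> nat" assume uv: "\<forall>s\<le>t. u s = v s"
  show "Q u = Q v"
    by (rule assms, rule state_cong) (use uv in auto)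
qed

lemma determined_own_past: "determined_by t (own_past i t h \<gamma>)"
  by (rule determined_by_stateI) (simp add: own_past_def walk_def)

lemma determined_past: "determined_by t (\<lambda>\<zeta>. \<forall>s\<le>t. walk i s \<zeta> = h s)"
  by (rule determined_by_stateI) (simp add: walk_def)

lemma determined_row: "determined_by t Q \<Longrightarrow> s \<le> t \<Longrightarrow> determined_by t (\<lambda>\<zeta>. Q \<zeta> \<and> \<zeta> s \<in> B)"
  unfolding determined_by_def by metis

lemma determined_Suc: "determined_by t Q \<Longrightarrow> determined_by (Suc t) Q"
  unfolding determined_by_def by auto

text \<open>Since \<open>exchange\<close> is an involution, exactly one input and one set of unmet signs lead to a prescribed next position and prescribed
new unmet signs.\<close>

lemma own_past_Suc:
  assumes w: "w \<in> {a..<n}" and h: "h (Suc t) = (h t + w) mod n"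
    and \<gamma>: "\<gamma> \<subseteq> {1..d} - bits i" and sw: "exchange (bits i) (w, \<gamma>) = (z, \<gamma>')"
  shows "measure \<Omega> {\<omega>. own_past i (Suc t) h \<gamma> (row \<omega>)} =
    measure \<Omega> {\<omega>. own_past i t h \<gamma>' (row \<omega>)} / (n - a)"
proof -
  let ?B = "bits i"
  have sw': "exchange ?B (z, \<gamma>') = (w, \<gamma>)"
    using exchange_involution[OF w \<gamma>] by (simp add: sw)
  have z: "z \<in> {a..<n}" "\<gamma>' \<subseteq> {1..d} - ?B"
    using exchange_mem[OF w \<gamma>] by (auto simp: sw)
  have "own_past i (Suc t) h \<gamma> \<zeta> \<longleftrightarrow> own_past i t h \<gamma>' \<zeta> \<and> \<zeta> (Suc t) \<in> {z}" if legal: "legal \<zeta>" for \<zeta>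
  proof -
    let ?x = "\<zeta> (Suc t)" and ?\<delta> = "snd (state \<zeta> t) - ?B"
    have x: "?x \<in> {a..<n}" using legal by (auto simp: legal_def)
    have \<delta>: "?\<delta> \<subseteq> {1..d} - ?B" using legal_state[OF legal] by auto
    have sx: "exchange ?B (?x, ?\<delta>) = (jump ?B ?x ?\<delta>, snd (state \<zeta> (Suc t)) - ?B)"
      by (simp add: exchange_def exchange_reduced(2)[of ?x "snd (state \<zeta> t)" ?B])
    have Dn: "jump ?B ?x ?\<delta> \<in> {a..<n}" using jump_block(1)[OF x] .
    have inj: "u = w" if "(h t + u) mod n = (h t + w) mod n" "u < n" for u
    proof -
      have "int n dvd int u - int w"
        using that(1) by (metis add_diff_cancel_left mod_eq_dvd_iff of_nat_add zmod_int)
      moreover have "\<bar>int u - int w\<bar> < int n" using that(2) w by auto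
      ultimately show ?thesis using no_dvd_small[of "int u - int w"] by linarith
    qed
    have all: "(\<forall>s\<le>Suc t. walk i s \<zeta> = h s) \<longleftrightarrow> (\<forall>s\<le>t. walk i s \<zeta> = h s) \<and> walk i (Suc t) \<zeta> = h (Suc t)"
      by (auto simp: le_Suc_eq)
    have "walk i (Suc t) \<zeta> = h (Suc t) \<longleftrightarrow> jump ?B ?x ?\<delta> = w" if "walk i t \<zeta> = h t"
      using walk_step[OF legal, of i t] inj[of "jump ?B ?x ?\<delta>"] Dn that h by auto
    then have "own_past i (Suc t) h \<gamma> \<zeta> \<longleftrightarrow> (\<forall>s\<le>t. walk i s \<zeta> = h s) \<and> exchange ?B (?x, ?\<delta>) = (w, \<gamma>)"
      unfolding own_past_def all sx by auto
    also have "exchange ?B (?x, ?\<delta>) = (w, \<gamma>) \<longleftrightarrow> (?x, ?\<delta>) = (z, \<gamma>')"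
      using exchange_involution[OF x \<delta>] sw sw' by auto
    finally show ?thesis unfolding own_past_def by auto
  qed
  then have "measure \<Omega> {\<omega>. own_past i (Suc t) h \<gamma> (row \<omega>)} =
      measure \<Omega> {\<omega>. own_past i t h \<gamma>' (row \<omega>) \<and> row \<omega> (Suc t) \<in> {z}}"
    by (rule measure_legal_eq[OF _ determined_own_past determined_row[OF determined_Suc[OF determined_own_past]]])
      simp_all
  also have "\<dots> = measure \<Omega> {\<omega>. own_past i t h \<gamma>' (row \<omega>)} * measure (measure_pmf (input (Suc t))) {z}"
    by (rule measure_next_row[OF determined_own_past])
  also have "measure (measure_pmf (input (Suc t))) {z} = 1 / (n - a)"
    using z(1) by (simp only: measure_input_Suc) simp
  finally show ?thesis by simp
qed

lemma own_past_zero: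
  assumes no: "\<not> (\<exists>w\<in>{a..<n}. h (Suc t) = (h t + w) mod n)"
  shows "measure \<Omega> {\<omega>. own_past i (Suc t) h \<gamma> (row \<omega>)} = 0"
proof -
  have "\<not> own_past i (Suc t) h \<gamma> \<zeta>" if legal: "legal \<zeta>" for \<zeta>
  proof
    assume op: "own_past i (Suc t) h \<gamma> \<zeta>"
    have "\<zeta> (Suc t) \<in> {a..<n}" using legal by (auto simp: legal_def)
    then have "jump (bits i) (\<zeta> (Suc t)) (snd (state \<zeta> t) - bits i) \<in> {a..<n}" by (rule jump_block(1))
    moreover have "walk i t \<zeta> = h t" "walk i (Suc t) \<zeta> = h (Suc t)" using op by (auto simp: own_past_def)
    then have "h (Suc t) = (h t + jump (bits i) (\<zeta> (Suc t)) (snd (state \<zeta> t) - bits i)) mod n"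
      using walk_step[OF legal, of i t] by (simp only:)
    ultimately show False using no by blast
  qed
  then have "measure \<Omega> {\<omega>. own_past i (Suc t) h \<gamma> (row \<omega>)} = measure \<Omega> {\<omega>. False}"
    by (intro measure_legal_eq[OF _ determined_own_past, where s = 0]) (auto simp: determined_by_def)
  then show ?thesis by simp
qed

text \<open>By \<open>own_past_Suc\<close> the probability of a history decreases by the same factor in each round, whatever the unmet signs
are, and the initial signs are independent of each other.\<close>

lemma own_past_uniform:
  assumes "\<gamma> \<subseteq> {1..d} - bits i" "\<gamma>' \<subseteq> {1..d} - bits i" and i: "i < 2 ^ d"
  shows "measure \<Omega> {\<omega>. own_past i t h \<gamma> (row \<omega>)} = measure \<Omega> {\<omega>. own_past i t h \<gamma>' (row \<omega>)}"
  using assms(1,2)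
proof (induction t arbitrary: \<gamma> \<gamma>')
  case 0
  let ?B = "bits i" and ?E = "set_encode ` Pow {1..d}"
  define F where "F \<delta> = {m \<in> ?E. pos 0 (set_decode m) i = h 0 \<and> set_decode m - ?B = \<delta>}" for \<delta>
  have fin: "finite A" if "A \<subseteq> {1..d}" for A using that by (rule finite_subset) simp
  have B: "?B \<subseteq> {1..d}" using bits_subset[OF i] .
  \<comment> \<open>replaces the unmet signs in a code by \<open>\<delta>\<close>; this maps \<open>F \<epsilon>\<close> bijectively to \<open>F \<delta>\<close>\<close>
  define T where "T \<delta> m = set_encode ((set_decode m \<inter> ?B) \<union> \<delta>)" for \<delta> m
  have T: "T \<delta> m \<in> F \<delta> \<and> set_decode (T \<delta> m) \<inter> ?B = set_decode m \<inter> ?B"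
    if "\<delta> \<subseteq> {1..d} - ?B" "m \<in> F \<epsilon>" for \<delta> \<epsilon> m
  proof -
    have sub: "(set_decode m \<inter> ?B) \<union> \<delta> \<subseteq> {1..d}" using that B by auto
    have dec: "set_decode (T \<delta> m) = (set_decode m \<inter> ?B) \<union> \<delta>"
      unfolding T_def using fin[OF sub] by simp
    have cap: "((set_decode m \<inter> ?B) \<union> \<delta>) \<inter> ?B = set_decode m \<inter> ?B" using that(1) by auto
    have "T \<delta> m \<in> ?E" unfolding T_def using sub by blast
    moreover have "pos 0 (set_decode (T \<delta> m)) i = pos 0 (set_decode m) i"
      unfolding pos_def offset_def dec cap ..
    moreover have "set_decode (T \<delta> m) - ?B = \<delta>" unfolding dec using that(1) by auto
    ultimately show ?thesis using that(2) cap dec by (simp add: F_def)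
  qed
  have TT: "T \<delta> (T \<epsilon> m) = m" if "\<epsilon> \<subseteq> {1..d} - ?B" "m \<in> F \<delta>" for \<delta> \<epsilon> m
  proof -
    have "(set_decode (T \<epsilon> m) \<inter> ?B) \<union> \<delta> = set_decode m"
      using T[OF that] that(2) by (auto simp: F_def)
    then show ?thesis by (simp add: T_def[of \<delta>])
  qed
  have "bij_betw (T \<gamma>') (F \<gamma>) (F \<gamma>')"
    by (rule bij_betwI[where g = "T \<gamma>"]) (use T TT 0 in auto)
  then have card: "card (F \<gamma>) = card (F \<gamma>')" by (rule bij_betw_same_card)
  have "measure \<Omega> {\<omega>. own_past i 0 h \<delta> (row \<omega>)} = card (F \<delta>) / card ?E" for \<delta>
  proof -
    have "measure \<Omega> {\<omega>. own_past i 0 h \<delta> (row \<omega>)} =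
        measure \<Omega> {\<omega>. row \<omega> 0 \<in> {m. pos 0 (set_decode m) i = h 0 \<and> set_decode m - ?B = \<delta>}}"
      by (simp add: own_past_def walk_def)
    also have "\<dots> = measure (measure_pmf (input 0)) {m. pos 0 (set_decode m) i = h 0 \<and> set_decode m - ?B = \<delta>}"
      by (rule measure_row)
    also have "\<dots> = card (F \<delta>) / card ?E"
    proof -
      have "?E \<inter> {m. pos 0 (set_decode m) i = h 0 \<and> set_decode m - ?B = \<delta>} = F \<delta>"
        by (auto simp: F_def)
      then show ?thesis unfolding input_def by (subst measure_pmf_of_set) auto
    qed
    finally show ?thesis .
  qed
  then show ?case using card by simp
next
  case (Suc t)
  show ?case
  proof (cases "\<exists>w\<in>{a..<n}. h (Suc t) = (h t + w) mod n")
    case False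
    then show ?thesis by (simp add: own_past_zero)
  next
    case True
    then obtain w where w: "w \<in> {a..<n}" "h (Suc t) = (h t + w) mod n" by blast
    obtain z1 \<delta>1 where 1: "exchange (bits i) (w, \<gamma>) = (z1, \<delta>1)" by force
    obtain z2 \<delta>2 where 2: "exchange (bits i) (w, \<gamma>') = (z2, \<delta>2)" by force
    have "\<delta>1 \<subseteq> {1..d} - bits i" "\<delta>2 \<subseteq> {1..d} - bits i"
      using exchange_mem[OF w(1) Suc.prems(1)] exchange_mem[OF w(1) Suc.prems(2)] by (auto simp: 1 2)
    then have "measure \<Omega> {\<omega>. own_past i t h \<delta>1 (row \<omega>)} = measure \<Omega> {\<omega>. own_past i t h \<delta>2 (row \<omega>)}"
      by (rule Suc.IH)
    then show ?thesis
      by (simp only: own_past_Suc[where i = i, OF w Suc.prems(1) 1] own_past_Suc[where i = i, OF w Suc.prems(2) 2])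
  qed
qed

lemma past_eq_own_past:
  assumes i: "i < 2 ^ d"
  shows "measure \<Omega> {\<omega>. \<forall>s\<le>t. walk i s (row \<omega>) = h s} =
    card (Pow ({1..d} - bits i)) * measure \<Omega> {\<omega>. own_past i t h {} (row \<omega>)}"
proof -
  interpret prob_space \<Omega> by (rule prob_space_coord_space)
  let ?\<Gamma> = "Pow ({1..d} - bits i)"
  have det: "determined_by t (\<lambda>\<zeta>. \<exists>\<gamma>\<in>?\<Gamma>. own_past i t h \<gamma> \<zeta>)"
    by (rule determined_by_stateI) (simp add: own_past_def walk_def)
  have "measure \<Omega> {\<omega>. \<forall>s\<le>t. walk i s (row \<omega>) = h s} =
      measure \<Omega> {\<omega>. \<exists>\<gamma>\<in>?\<Gamma>. own_past i t h \<gamma> (row \<omega>)}"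
  proof (rule measure_legal_eq[OF _ determined_past det])
    fix \<zeta> assume "legal \<zeta>"
    then show "(\<forall>s\<le>t. walk i s \<zeta> = h s) = (\<exists>\<gamma>\<in>?\<Gamma>. own_past i t h \<gamma> \<zeta>)"
      using legal_state[of \<zeta> t] by (auto simp: own_past_def)
  qed
  also have "{\<omega>. \<exists>\<gamma>\<in>?\<Gamma>. own_past i t h \<gamma> (row \<omega>)} = (\<Union>\<gamma>\<in>?\<Gamma>. {\<omega>. own_past i t h \<gamma> (row \<omega>)})" by auto
  also have "measure \<Omega> \<dots> = (\<Sum>\<gamma>\<in>?\<Gamma>. measure \<Omega> {\<omega>. own_past i t h \<gamma> (row \<omega>)})"
  proof (rule finite_measure_finite_Union)
    show "(\<lambda>\<gamma>. {\<omega>. own_past i t h \<gamma> (row \<omega>)}) ` ?\<Gamma> \<subseteq> sets \<Omega>"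
      using sets_determined[OF determined_own_past] by blast
    show "disjoint_family_on (\<lambda>\<gamma>. {\<omega>. own_past i t h \<gamma> (row \<omega>)}) ?\<Gamma>"
      unfolding disjoint_family_on_def own_past_def by blast
  qed simp
  also have "\<dots> = (\<Sum>\<gamma>\<in>?\<Gamma>. measure \<Omega> {\<omega>. own_past i t h {} (row \<omega>)})"
    by (intro sum.cong refl own_past_uniform[OF _ _ i]) auto
  finally show ?thesis by simp
qed

lemma next_position_uniform:
  assumes i: "i < 2 ^ d"
  shows "measure \<Omega> {\<omega>. (\<forall>s\<le>t. walk i s (row \<omega>) = h s) \<and> walk i (Suc t) (row \<omega>) = y} =
    (if \<exists>w\<in>{a..<n}. y = (h t + w) mod n
     then measure \<Omega> {\<omega>. \<forall>s\<le>t. walk i s (row \<omega>) = h s} / (n - a) else 0)"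
proof -
  define h' where "h' = h(Suc t := y)"
  have h': "h' t = h t" "h' (Suc t) = y" by (simp_all add: h'_def)
  have own: "own_past i t h' \<gamma> = own_past i t h \<gamma>" for \<gamma>
    by (auto simp: own_past_def h'_def fun_eq_iff)
  have "(\<forall>s\<le>t. walk i s \<zeta> = h s) \<and> walk i (Suc t) \<zeta> = y \<longleftrightarrow> (\<forall>s\<le>Suc t. walk i s \<zeta> = h' s)" for \<zeta>
    by (auto simp: h'_def le_Suc_eq)
  then have eq: "measure \<Omega> {\<omega>. (\<forall>s\<le>t. walk i s (row \<omega>) = h s) \<and> walk i (Suc t) (row \<omega>) = y} =
      card (Pow ({1..d} - bits i)) * measure \<Omega> {\<omega>. own_past i (Suc t) h' {} (row \<omega>)}"
    using past_eq_own_past[OF i, of "Suc t" h'] by simp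
  show ?thesis
  proof (cases "\<exists>w\<in>{a..<n}. y = (h t + w) mod n")
    case False
    then show ?thesis unfolding eq using own_past_zero[of h' t i "{}"] h' by simp
  next
    case True
    then obtain w where w: "w \<in> {a..<n}" "h' (Suc t) = (h' t + w) mod n" using h' by auto
    obtain z \<gamma> where sw: "exchange (bits i) (w, {}) = (z, \<gamma>)" by force
    then have "\<gamma> \<subseteq> {1..d} - bits i" using exchange_mem[OF w(1), of "{}" "bits i"] by auto
    have "measure \<Omega> {\<omega>. own_past i (Suc t) h' {} (row \<omega>)} =
        measure \<Omega> {\<omega>. own_past i t h' \<gamma> (row \<omega>)} / (n - a)"
      by (rule own_past_Suc[OF w _ sw]) simp
    also have "measure \<Omega> {\<omega>. own_past i t h' \<gamma> (row \<omega>)} = measure \<Omega> {\<omega>. own_past i t h {} (row \<omega>)}"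
      unfolding own by (rule own_past_uniform[OF \<open>\<gamma> \<subseteq> _\<close> _ i]) simp
    finally show ?thesis
      using True by (simp only: eq past_eq_own_past[OF i] if_True times_divide_eq_right)
  qed
qed

lemma random_walk_walk:
  assumes i: "i < 2 ^ d"
    and N: "\<And>v. v < n \<Longrightarrow> N v = {y. \<exists>w\<in>{a..<n}. y = (v + w) mod n}"
  shows "random_walk \<Omega> {..<n} N (\<lambda>t \<omega>. walk i t (row \<omega>))"
  unfolding random_walk_def
proof (intro conjI allI impI)
  fix t
  have "determined_by t (walk i t)"
    by (rule determined_by_stateI) (simp add: walk_def)
  then have "(\<lambda>\<omega>. walk i t (row \<omega>)) \<in> measurable \<Omega> (count_space UNIV)"
    by (rule measurable_determined)
  then show "(\<lambda>\<omega>. walk i t (row \<omega>)) \<in> measurable \<Omega> (count_space {..<n})"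
    using walk_less by (auto simp: measurable_def)
next
  fix t h y
  assume "\<P>(\<omega> in \<Omega>. \<forall>s\<le>t. walk i s (row \<omega>) = h s) > 0"
  then have pos: "measure \<Omega> {\<omega>. \<forall>s\<le>t. walk i s (row \<omega>) = h s} > 0" by simp
  then have "{\<omega>. \<forall>s\<le>t. walk i s (row \<omega>) = h s} \<noteq> {}" by force
  then obtain \<omega> where "\<forall>s\<le>t. walk i s (row \<omega>) = h s" by blast
  then have hn: "h t < n" using walk_less[of i t "row \<omega>"] by simp
  have inj: "inj_on (\<lambda>w. (h t + w) mod n) {a..<n}"
  proof (rule inj_onI)
    fix u w assume uw: "u \<in> {a..<n}" "w \<in> {a..<n}" "(h t + u) mod n = (h t + w) mod n"
    have "int n dvd int u - int w"
      using uw(3) by (metis add_diff_cancel_left mod_eq_dvd_iff of_nat_add zmod_int)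
    moreover have "\<bar>int u - int w\<bar> < int n" using uw by auto
    ultimately show "u = w" using no_dvd_small[of "int u - int w"] by linarith
  qed
  have Nimg: "N (h t) = (\<lambda>w. (h t + w) mod n) ` {a..<n}" unfolding N[OF hn] by auto
  then have card: "card (N (h t)) = n - a" "finite (N (h t))" "N (h t) \<noteq> {}"
    using card_image[OF inj] displacements by auto
  show "\<P>(\<omega> in \<Omega>. walk i (Suc t) (row \<omega>) = y \<bar> \<forall>s\<le>t. walk i s (row \<omega>) = h s) =
      pmf (pmf_of_set (N (h t))) y"
    using next_position_uniform[OF i, of t h y] pos card
    by (simp add: cond_prob_def conj_commute N[OF hn])
qed

end

section \<open>Avoidance, the Markov property and the bound on the number of walkers\<close>

context tiling
begin

lemma avoiding_walk:
  assumes k: "k \<le> 2 ^ d"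
  shows "avoiding \<Omega> k (\<lambda>i t \<omega>. walk i t (row \<omega>))"
  unfolding avoiding_def
proof -
  have "walk i t \<zeta> \<noteq> walk j t \<zeta>" if "i < k" "j < k" "i \<noteq> j" for i j t \<zeta>
    unfolding walk_def using that k by (intro distinct_positions) auto
  moreover have "walk i (Suc t) \<zeta> \<noteq> walk j t \<zeta>" if "legal \<zeta>" "i < j" "j < k" for i j t \<zeta>
    unfolding walk_Suc unfolding walk_def
    using that k legal_state[OF that(1), of t] by (intro no_collision) (auto simp: legal_def)
  ultimately show "AE \<omega> in \<Omega>. \<forall>t. \<forall>i<k. \<forall>j<k.
      (i \<noteq> j \<longrightarrow> walk i t (row \<omega>) \<noteq> walk j t (row \<omega>)) \<and>
      (i < j \<longrightarrow> walk i (Suc t) (row \<omega>) \<noteq> walk j t (row \<omega>))"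
    using AE_legal by (auto elim!: eventually_mono)
qed

text \<open>Any state that explains the current positions may be used, because they all give the same law.\<close>

definition kernel :: "nat \<Rightarrow> nat \<Rightarrow> (nat \<Rightarrow> nat) \<Rightarrow> nat pmf" where
  "kernel k j cur = (SOME \<mu>. \<exists>c G. G \<subseteq> {1..d} \<and> (\<forall>i. j \<le> i \<and> i < k \<longrightarrow> pos c G i = cur i) \<and>
     compatible c G j cur \<noteq> {} \<and> \<mu> = move_law c G j cur)"

lemma kernel_eq_move_law:
  assumes k: "\<And>l. l \<in> {1..d} \<Longrightarrow> 2 ^ (l - 1) < k" "k \<le> 2 ^ d" and j: "j < k"
    and G: "G \<subseteq> {1..d}" and pos: "\<And>i. j \<le> i \<Longrightarrow> i < k \<Longrightarrow> pos c G i = cur i"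
    and ne: "compatible c G j cur \<noteq> {}"
  shows "kernel k j cur = move_law c G j cur"
proof -
  let ?P = "\<lambda>\<mu>. \<exists>c G. G \<subseteq> {1..d} \<and> (\<forall>i. j \<le> i \<and> i < k \<longrightarrow> pos c G i = cur i) \<and>
     compatible c G j cur \<noteq> {} \<and> \<mu> = move_law c G j cur"
  have "?P (move_law c G j cur)" using G pos ne by blast
  then have "?P (kernel k j cur)" unfolding kernel_def by (rule someI[where P = ?P])
  then obtain c' G' where *: "G' \<subseteq> {1..d}" "\<And>i. j \<le> i \<Longrightarrow> i < k \<Longrightarrow> pos c' G' i = cur i"
    "compatible c' G' j cur \<noteq> {}" "kernel k j cur = move_law c' G' j cur" by blast
  show ?thesis
    unfolding *(4) by (rule move_law_unique[OF k j *(1) G *(2) pos *(3) ne])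
qed

text \<open>The positions at time \<open>t\<close> fix the state, up to multiples of \<open>n\<close> in the origin, so the moves already made in the round constrain only the next input,
which is independent of the past. Given the past, this input is therefore uniform on the compatible values.\<close>

lemma markovian_walk:
  assumes k: "\<And>l. l \<in> {1..d} \<Longrightarrow> 2 ^ (l - 1) < k" "k \<le> 2 ^ d"
  shows "markovian \<Omega> k (\<lambda>i t \<omega>. walk i t (row \<omega>))"
  unfolding markovian_def
proof (intro exI[of _ "kernel k"] allI impI)
  fix j t y :: nat and h :: "nat \<Rightarrow> nat \<Rightarrow> nat"
  assume j: "j < k"
  let ?cur = "current k j t h"
  define R where "R \<zeta> \<longleftrightarrow> (\<forall>i<k. \<forall>s\<le>t. walk i s \<zeta> = h i s)" for \<zeta>
  have past: "(\<forall>(i, s)\<in>past k j t. walk i s \<zeta> = h i s) \<longleftrightarrow> R \<zeta> \<and> (\<forall>i<j. walk i (Suc t) \<zeta> = h i (Suc t))" for \<zeta>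
    unfolding past_def R_def using j by auto
  have detR: "determined_by t R"
    by (rule determined_by_stateI) (simp add: R_def walk_def)
  assume "\<P>(\<omega> in \<Omega>. \<forall>(i, s)\<in>past k j t. walk i s (row \<omega>) = h i s) > 0"
  then have pos: "measure \<Omega> {\<omega>. R (row \<omega>) \<and> (\<forall>i<j. walk i (Suc t) (row \<omega>) = h i (Suc t))} > 0"
    by (simp add: past)
  have det: "determined_by (Suc t) (\<lambda>\<zeta>. R \<zeta> \<and> (\<forall>i<j. walk i (Suc t) \<zeta> = h i (Suc t)))"
    by (rule determined_by_stateI) (simp add: R_def walk_def del: state.simps)
  have "\<exists>\<zeta>. legal \<zeta> \<and> R \<zeta> \<and> (\<forall>i<j. walk i (Suc t) \<zeta> = h i (Suc t))"
  proof (rule ccontr)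
    assume "\<not> ?thesis"
    then have "measure \<Omega> {\<omega>. R (row \<omega>) \<and> (\<forall>i<j. walk i (Suc t) (row \<omega>) = h i (Suc t))} = measure \<Omega> {\<omega>. False}"
      by (intro measure_legal_eq[OF _ det, where s = 0]) (auto simp: determined_by_def)
    with pos show False by simp
  qed
  then obtain \<eta> where \<eta>: "legal \<eta>" "R \<eta>" "\<And>i. i < j \<Longrightarrow> walk i (Suc t) \<eta> = h i (Suc t)" by blast
  define c where "c = fst (state \<eta> t)"
  define G where "G = snd (state \<eta> t)"
  have G: "G \<subseteq> {1..d}" unfolding G_def by (rule legal_state[OF \<eta>(1)])
  have pos_h: "pos c G i = h i t" if "i < k" for i
    using \<eta>(2) that by (simp add: R_def walk_def c_def G_def)
  have step: "walk i (Suc t) \<zeta> = moved c G (\<zeta> (Suc t)) i" if "legal \<zeta>" "R \<zeta>" for \<zeta> i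
  proof -
    let ?c = "fst (state \<zeta> t)" and ?G = "snd (state \<zeta> t)"
    have "pos ?c ?G i = pos c G i" if "i < k" for i
      using \<open>R \<zeta>\<close> that pos_h[OF that] by (simp add: R_def walk_def)
    then have "?G = G" "int n dvd ?c - c"
      using state_unique[of k ?G G ?c c] k(1) legal_state[OF that(1), of t] G j by auto
    then show ?thesis by (simp add: walk_Suc moved_cong)
  qed
  have cur_low: "?cur i = h i (Suc t)" if "i < j" for i using that j by (simp add: current_def)
  have cur_high: "?cur i = h i t" if "j \<le> i" "i < k" for i using that by (simp add: current_def)
  let ?K = "compatible c G j ?cur"
  have "\<eta> (Suc t) \<in> ?K"
    using \<eta> step[OF \<eta>(1,2)] cur_low by (simp add: compatible_def legal_def)
  then have ne: "?K \<noteq> {}" by blast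
  have K_sub: "?K \<subseteq> {a..<n}" by (auto simp: compatible_def)
  have prob: "measure \<Omega> {\<omega>. R (row \<omega>) \<and> (\<forall>i<j. walk i (Suc t) (row \<omega>) = h i (Suc t)) \<and> walk j (Suc t) (row \<omega>) \<in> Y} =
      measure \<Omega> {\<omega>. R (row \<omega>)} * (card {z \<in> ?K. moved c G z j \<in> Y} / (n - a))" for Y
  proof -
    have "measure \<Omega> {\<omega>. R (row \<omega>) \<and> (\<forall>i<j. walk i (Suc t) (row \<omega>) = h i (Suc t)) \<and> walk j (Suc t) (row \<omega>) \<in> Y} =
      measure \<Omega> {\<omega>. R (row \<omega>) \<and> row \<omega> (Suc t) \<in> {z \<in> ?K. moved c G z j \<in> Y}}"
    proof (rule measure_legal_eq)
      fix \<zeta> assume g: "legal \<zeta>"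
      then have "\<zeta> (Suc t) \<in> {a..<n}" by (auto simp: legal_def)
      then show "(R \<zeta> \<and> (\<forall>i<j. walk i (Suc t) \<zeta> = h i (Suc t)) \<and> walk j (Suc t) \<zeta> \<in> Y) =
        (R \<zeta> \<and> \<zeta> (Suc t) \<in> {z \<in> ?K. moved c G z j \<in> Y})"
        using step[OF g] cur_low by (auto simp: compatible_def)
    next
      show "determined_by (Suc t) (\<lambda>\<zeta>. R \<zeta> \<and> (\<forall>i<j. walk i (Suc t) \<zeta> = h i (Suc t)) \<and> walk j (Suc t) \<zeta> \<in> Y)"
        by (rule determined_by_stateI) (simp add: R_def walk_def del: state.simps)
      show "determined_by (Suc t) (\<lambda>\<zeta>. R \<zeta> \<and> \<zeta> (Suc t) \<in> {z \<in> ?K. moved c G z j \<in> Y})"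
        by (rule determined_row[OF determined_Suc[OF detR]]) simp
    qed
    also have "\<dots> = measure \<Omega> {\<omega>. R (row \<omega>)} * measure (measure_pmf (input (Suc t))) {z \<in> ?K. moved c G z j \<in> Y}"
      by (rule measure_next_row[OF detR])
    also have "{a..<n} \<inter> {z \<in> ?K. moved c G z j \<in> Y} = {z \<in> ?K. moved c G z j \<in> Y}" using K_sub by auto
    then have "measure (measure_pmf (input (Suc t))) {z \<in> ?K. moved c G z j \<in> Y} = card {z \<in> ?K. moved c G z j \<in> Y} / (n - a)"
      by (simp only: measure_input_Suc)
    finally show ?thesis .
  qed
  \<comment> \<open>all factors but the two cardinalities cancel in the conditional probability\<close>
  have R0: "measure \<Omega> {\<omega>. R (row \<omega>)} \<noteq> 0"
    using pos prob[of UNIV] by auto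
  have L0: "real (n - a) \<noteq> 0" using displacements by simp
  have "\<P>(\<omega> in \<Omega>. walk j (Suc t) (row \<omega>) = y \<bar> \<forall>(i, s)\<in>past k j t. walk i s (row \<omega>) = h i s) =
      measure \<Omega> {\<omega>. R (row \<omega>) \<and> (\<forall>i<j. walk i (Suc t) (row \<omega>) = h i (Suc t)) \<and> walk j (Suc t) (row \<omega>) \<in> {y}} /
      measure \<Omega> {\<omega>. R (row \<omega>) \<and> (\<forall>i<j. walk i (Suc t) (row \<omega>) = h i (Suc t)) \<and> walk j (Suc t) (row \<omega>) \<in> UNIV}"
    unfolding cond_prob_def past by (simp add: conj_ac)
  also have "\<dots> = card {z \<in> ?K. moved c G z j \<in> {y}} / card ?K"
    unfolding prob using R0 L0 by simp
  also have "\<dots> = pmf (move_law c G j ?cur) y"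
  proof -
    have "?K \<inter> (\<lambda>z. moved c G z j) -` {y} = {z \<in> ?K. moved c G z j \<in> {y}}" by auto
    then show ?thesis
      unfolding move_law_def pmf_map by (subst measure_pmf_of_set[OF ne finite_compatible]) simp
  qed
  also have "move_law c G j ?cur = kernel k j ?cur"
  proof (rule kernel_eq_move_law[OF k j G _ ne, symmetric])
    fix i assume "j \<le> i" "i < k"
    then show "pos c G i = ?cur i" using pos_h[of i] cur_high[of i] by simp
  qed
  finally show "\<P>(\<omega> in \<Omega>. walk j (Suc t) (row \<omega>) = y \<bar> \<forall>(i, s)\<in>past k j t. walk i s (row \<omega>) = h i s) =
      pmf (kernel k j ?cur) y" .
qed

lemma markovian_avoidance_coupling_walk:
  assumes k: "\<And>l. l \<in> {1..d} \<Longrightarrow> 2 ^ (l - 1) < k" "k \<le> 2 ^ d"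
    and N: "\<And>v. v < n \<Longrightarrow> N v = {y. \<exists>w\<in>{a..<n}. y = (v + w) mod n}"
  shows "markovian_avoidance_coupling \<Omega> k {..<n} N (\<lambda>i t \<omega>. walk i t (row \<omega>))"
  unfolding markovian_avoidance_coupling_def coupling_def
  using random_walk_walk[OF _ N] k(2) avoiding_walk[OF k(2)] markovian_walk[OF k] prob_space_coord_space
  by auto

end

lemma nbhd_K_star_translates:
  assumes "v < n"
  shows "nbhd_K_star n v = {y. \<exists>w\<in>{0..<n}. y = (v + w) mod n}"
proof -
  have "\<exists>w\<in>{0..<n}. y = (v + w) mod n" if "y < n" for y
    by (rule bexI[of _ "(y + (n - v)) mod n"]) (use that assms in \<open>auto simp: mod_add_right_eq\<close>)
  then show ?thesis using assms by (auto simp: nbhd_K_star_def)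
qed

lemma nbhd_K_translates:
  assumes "v < n"
  shows "nbhd_K n v = {y. \<exists>w\<in>{1..<n}. y = (v + w) mod n}"
proof -
  have "(v + w) mod n \<noteq> v" if "w \<in> {1..<n}" for w
    using assms that by (auto simp: mod_if)
  moreover have "\<exists>w\<in>{1..<n}. y = (v + w) mod n" if "y < n" "y \<noteq> v" for y
  proof -
    have "y \<in> nbhd_K_star n v" using that by (simp add: nbhd_K_star_def)
    then obtain w where w: "w \<in> {0..<n}" "y = (v + w) mod n"
      unfolding nbhd_K_star_translates[OF assms] by blast
    then have "w \<noteq> 0" using that assms by (intro notI) simp
    then show ?thesis using w by (intro bexI[of _ w]) auto
  qed
  ultimately show ?thesis using assms by (auto simp: nbhd_K_def)
qed

lemma walker_bits:
  assumes "k \<ge> (1::nat)"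
  obtains d where "k \<le> 2 ^ d" "\<And>l. l \<in> {1..d} \<Longrightarrow> 2 ^ (l - 1) < k"
proof -
  define d where "d = (LEAST d. k \<le> 2 ^ d)"
  have "k \<le> 2 ^ k" using less_exp[of k] by linarith
  then have "k \<le> 2 ^ d" unfolding d_def by (rule LeastI[where P = "\<lambda>d. k \<le> 2 ^ d"])
  moreover have "2 ^ (l - 1) < k" if "l \<in> {1..d}" for l
  proof -
    have "l - 1 < (LEAST d. k \<le> 2 ^ d)" using that unfolding d_def[symmetric] by auto
    then have "\<not> k \<le> 2 ^ (l - 1)" by (rule not_less_Least)
    then show ?thesis by simp
  qed
  ultimately show ?thesis by (rule that)
qed

text \<open>From \<open>8 * 2 ^ (d - 1) \<le> 8 * k \<le> n\<close> one gets \<open>d + 2 \<le> log 2 n\<close>, and this turns the logarithm in the hypothesis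
into the number of full blocks that the tiling needs.\<close>

lemma enough_room:
  fixes n k d :: nat
  assumes n: "n \<ge> 2" and k: "k \<ge> 1" and d: "d \<ge> 1" "2 ^ (d - 1) < k"
    and bound: "real k \<le> real n / (8 * log 2 (real n))"
  shows "(d + 2) * 2 ^ Suc d \<le> n - 1"
proof -
  define L where "L = log 2 (real n)"
  have L1: "L \<ge> 1" unfolding L_def using n by (subst le_log_iff) auto
  have b: "8 * real k * L \<le> real n"
    using bound L1 unfolding L_def[symmetric] by (simp add: field_simps)
  have "8 * real k * 1 \<le> 8 * real k * L" by (rule mult_left_mono) (use L1 in auto)
  then have "8 * real k \<le> real n" using b by linarith
  moreover have "real (2 ^ (d - 1)) < real k" using d(2) by (simp only: of_nat_less_iff)
  ultimately have "8 * real (2 ^ (d - 1)) \<le> real n" by linarith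
  moreover have "(2::real) ^ (d + 2) = 8 * 2 ^ (d - 1)"
    using d(1) by (cases d) (auto simp: power_add)
  moreover have "2 powr real (d + 2) = 2 ^ (d + 2)" by (rule powr_realpow) simp
  ultimately have "2 powr real (d + 2) \<le> real n" by (simp only: of_nat_power of_nat_numeral)
  then have "real (d + 2) \<le> L" unfolding L_def using n by (subst le_log_iff) auto
  then have "8 * real k * real (d + 2) \<le> 8 * real k * L" by (intro mult_left_mono) auto
  then have "8 * real k * real (d + 2) \<le> real n" using b by linarith
  then have "8 * k * (d + 2) \<le> n"
    by (metis of_nat_le_iff of_nat_mult of_nat_numeral)
  moreover have "(d + 2) * 2 ^ Suc d = 4 * (d + 2) * 2 ^ (d - 1)"
    using d(1) by (cases d) (auto simp: algebra_simps)
  moreover have "4 * (d + 2) * 2 ^ (d - 1) \<le> 4 * (d + 2) * k"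
    by (rule mult_left_mono) (use d(2) in auto)
  moreover have "4 * (d + 2) * k + 1 \<le> 8 * k * (d + 2)"
  proof -
    have "1 \<le> k * (d + 2)" using k by simp
    then show ?thesis by (simp add: algebra_simps)
  qed
  ultimately show ?thesis by linarith
qed

lemma coupling_exists:
  fixes n k a :: nat
  assumes n: "n \<ge> 2" and k: "k \<ge> 1" and a: "a \<le> 1"
    and bound: "real k \<le> real n / (8 * log 2 (real n))"
    and N: "\<And>v. v < n \<Longrightarrow> N v = {y. \<exists>w\<in>{a..<n}. y = (v + w) mod n}"
  shows "\<exists>(M :: (nat \<Rightarrow> nat \<Rightarrow> nat) measure) X. markovian_avoidance_coupling M k {..<n} N X"
proof -
  obtain d where d: "k \<le> 2 ^ d" "\<And>l. l \<in> {1..d} \<Longrightarrow> 2 ^ (l - 1) < k"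
    using walker_bits[OF k] by blast
  have "\<exists>start level. tiling n d a start level"
  proof (cases "d = 0")
    case True
    then show ?thesis using tiling_zero[OF a n] by blast
  next
    case False
    then have "(d + 2) * 2 ^ Suc d \<le> n - 1"
      using enough_room[OF n k _ _ bound, of d] d(2)[of d] by simp
    then have "(d + 2) * 2 ^ Suc d \<le> n - a" using a by linarith
    then show ?thesis using tiling_exists[OF a, of d n] False by (metis One_nat_def Suc_leI gr0I)
  qed
  then obtain start level where "tiling n d a start level" by blast
  then interpret tiling n d a start level .
  show ?thesis using markovian_avoidance_coupling_walk[OF d(2,1) N] by blast
qed

theorem theorem7p1:
  fixes n k :: nat
  assumes "n \<ge> 2" and "k \<ge> 1"
  shows "(real k \<le> real n / (8 * log 2 (real n)) \<longrightarrow>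
           (\<exists>(M :: (nat \<Rightarrow> nat \<Rightarrow> nat) measure) X.
              markovian_avoidance_coupling M k {..<n} (nbhd_K_star n) X)) \<and>
         (real k \<le> real n / (56 * log 2 (real n)) \<longrightarrow>
           (\<exists>(M :: (nat \<Rightarrow> nat \<Rightarrow> nat) measure) X.
              markovian_avoidance_coupling M k {..<n} (nbhd_K n) X))"
proof (intro conjI impI)
  assume "real k \<le> real n / (8 * log 2 (real n))"
  then show "\<exists>(M :: (nat \<Rightarrow> nat \<Rightarrow> nat) measure) X.
      markovian_avoidance_coupling M k {..<n} (nbhd_K_star n) X"
    by (rule coupling_exists[OF assms zero_le_one _ nbhd_K_star_translates])
next
  assume "real k \<le> real n / (56 * log 2 (real n))"
  also have "real n / (56 * log 2 (real n)) \<le> real n / (8 * log 2 (real n))"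
    using assms(1) by (intro divide_left_mono mult_pos_pos) auto
  finally show "\<exists>(M :: (nat \<Rightarrow> nat \<Rightarrow> nat) measure) X.
      markovian_avoidance_coupling M k {..<n} (nbhd_K n) X"
    by (rule coupling_exists[OF assms order_refl _ nbhd_K_translates])
qed

end
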